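(* Let $\mathcal H$ be a quasi-effective, compactly generated and strongly equicontinuous pseudogroup of local transformations of a locally compact Polish space $Z$. Let $S$ be a symmetric set of generators of $\mathcal H$ that is closed under compositions and restrictions to open subsets, and satisfies the conditions of strong equicontinuity and quasi-effectiveness. Let $\widetilde{\mathcal H}$ be the set of maps $h$ between open subsets of $Z$ that satisfy the following property: for every $x\in\operatorname{dom}h$, there exists a neighborhood $O_x$ of $x$ in $\operatorname{dom}h$ so that $h|_{O_x}$ is in the closure of $C(O_x,Z)\cap S$ in $C_{\text{c-o}}(O_x,Z)$. Then: (1) $\widetilde{\mathcal H}$ is closed under composition, combination and restriction to open sets; (2) every map in $\widetilde{\mathcal H}$ is a homeomorphism around every point of its domain; (3) the maps of $\widetilde{\mathcal H}$ that are homeomorphisms form a pseudogroup $\overline{\mathcal H}$ that contains $\mathcal H$; (4) $\overline{\mathcal H}$ is strongly equicontinuous; (5) the orbits of $\overline{\mathcal H}$ are equal to the closures of the orbits of $\mathcal H$; and (6) $\widetilde{\mathcal H}$ and $\overline{\mathcal H}$ are independent of the choice of $S$.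
   Context: $C(Y,Z)$ is the set of continuous maps $Y\to Z$, denoted $C_{\text{c-o}}(Y,Z)$ when endowed with the compact-open topology. For $O\subset Z$ open, $C(O,Z)\cap S$ is the set of elements of $S$ with domain $O$, regarded as maps $O\to Z$. **Pseudogroups.** A pseudogroup of local transformations of a space $Z$ is a collection $\mathcal H$ of homeomorphisms between open subsets of $Z$ containing $\mathrm{id}_Z$ and closed under composition (wherever defined), inversion, restriction to open sets and combination (union) of maps. It is generated by $E\subset\mathcal H$ if all its elements are obtained from $E$ by these operations. $E$ is symmetric if $h\in E\Rightarrow h^{-1}\in E$. The orbit of $x$ is $\{h(x): h\in\mathcal H,\ x\in\operatorname{dom}h\}$. The restriction of $\mathcal H$ to an open $U\subset Z$ consists of the $h\in\mathcal H$ with domain and image in $U$. **Compact generation.** $\mathcal H$ on a locally compact $Z$ is compactly generated if there is a relatively compact open $U\subset Z$ meeting every orbit such that the restriction $\mathcal G$ of $\mathcal H$ to $U$ is generated by a finite symmetric set $E\subset\mathcal G$ such that each $g\in E$ is the restriction of some $\bar g\in\mathcal H$ defined on a neighborhood of $\overline{\operatorname{dom}g}$. (Then such an $E$ exists for every relatively compact open $U$ meeting all orbits.) **Quasi-local metrics.** A cover of a set $Z$ by quasi-locally equal metric spaces is a family $\{(Z_i,d_i)\}_{i\in I}$ of metric spaces with $Z=\bigcup_iZ_i$, each $Z_i\cap Z_j$ open in $(Z_i,d_i)$ and in $(Z_j,d_j)$, such that for all $\varepsilon>0$ there is $\delta(\varepsilon)>0$ so that: for all $i,j\in I$ and $z\in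 Z_i\cap Z_j$ there is an open neighborhood $U_{i,j,z}$ of $z$ in $Z_i\cap Z_j$ with $d_i(x,y)<\delta(\varepsilon)\Rightarrow d_j(x,y)<\varepsilon$ for all $\varepsilon>0$ and $x,y\in U_{i,j,z}$. Two such families are equivalent if their union is again such a family; an equivalence class $\mathfrak Q$ is a quasi-local metric. It induces a topology on $Z$ with base the open balls of all $(Z_i,d_i)$. **Strong equicontinuity.** A pseudogroup $\mathcal H$ on a space $Z$ is strongly equicontinuous if there are a quasi-local metric $\mathfrak Q$ inducing the topology of $Z$, some $\{(Z_i,d_i)\}_{i\in I}\in\mathfrak Q$ and a symmetric set $S$ of generators of $\mathcal H$, closed under compositions, such that for every $\varepsilon>0$ there is $\delta(\varepsilon)>0$ with $d_i(x,y)<\delta(\varepsilon)\Rightarrow d_j(h(x),h(y))<\varepsilon$ for all $h\in S$, $i,j\in I$ and $x,y\in Z_i\cap h^{-1}(Z_j\cap\operatorname{im}h)$. Such an $S$ is said to satisfy the condition of strong equicontinuity. **Quasi-effectiveness.** $\mathcal H$ is quasi-effective if it is generated by some symmetric set $S$, closed under compositions, such that any transformation in $S$ is the identity on its domain if it is the identity on some non-empty open subset of its domain. Such an $S$ is said to satisfy the condition of quasi-effectiveness. *)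

theory Defs
  imports "HOL-Analysis.Analysis"
begin

text \<open>
  The space \<open>Z\<close> is the universe of a topological type. A map between subsets of \<open>Z\<close> is a partial
  map \<^typ>\<open>'a \<rightharpoonup> 'a\<close>, so that maps with different domains are different; the identity of \<open>Z\<close> is
  \<^const>\<open>Some\<close>, composition on the largest possible domain is \<^const>\<open>map_comp\<close>, and restriction is
  \<^const>\<open>restrict_map\<close>. The codomain is not part of the data.
\<close>

section \<open>Pseudogroups\<close>

definition local_homeo :: "('a::topological_space \<rightharpoonup> 'a) \<Rightarrow> bool" where
  "local_homeo h \<longleftrightarrow> open (dom h) \<and> open (ran h) \<and>
     (\<exists>g. homeomorphism (dom h) (ran h) (\<lambda>x. the (h x)) g)"

text \<open>Meaningful for maps that are injective on their domain.\<close>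
definition map_inverse :: "('a \<rightharpoonup> 'b) \<Rightarrow> ('b \<rightharpoonup> 'a)" where
  "map_inverse h = (\<lambda>y. if y \<in> ran h then Some (THE x. h x = Some y) else None)"

text \<open>Only families whose maps agree on common parts of their domains have a combination.\<close>
definition is_combination :: "('a \<rightharpoonup> 'b) set \<Rightarrow> ('a \<rightharpoonup> 'b) \<Rightarrow> bool" where
  "is_combination F h \<longleftrightarrow> Map.graph h = (\<Union>f\<in>F. Map.graph f)"

definition symmetric_maps :: "('a \<rightharpoonup> 'a) set \<Rightarrow> bool" where
  "symmetric_maps S \<longleftrightarrow> (\<forall>h\<in>S. map_inverse h \<in> S)"

definition closed_under_composition :: "('a \<rightharpoonup> 'a) set \<Rightarrow> bool" where
  "closed_under_composition S \<longleftrightarrow> (\<forall>g\<in>S. \<forall>h\<in>S. g \<circ>\<^sub>m h \<in> S)"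

definition closed_under_restriction :: "('a::topological_space \<rightharpoonup> 'a) set \<Rightarrow> bool" where
  "closed_under_restriction S \<longleftrightarrow> (\<forall>h\<in>S. \<forall>U. open U \<longrightarrow> h |` U \<in> S)"

definition closed_under_combination :: "('a \<rightharpoonup> 'a) set \<Rightarrow> bool" where
  "closed_under_combination S \<longleftrightarrow> (\<forall>F h. F \<subseteq> S \<and> is_combination F h \<longrightarrow> h \<in> S)"

text \<open>In a pseudogroup, only those combinations are considered that are again homeomorphisms.\<close>
definition pseudogroup :: "('a::topological_space \<rightharpoonup> 'a) set \<Rightarrow> bool" where
  "pseudogroup H \<longleftrightarrow>
     (\<forall>h\<in>H. local_homeo h) \<and>
     Some \<in> H \<and>
     closed_under_composition H \<and>
     symmetric_maps H \<and>
     closed_under_restriction H \<and>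
     (\<forall>F h. F \<subseteq> H \<and> is_combination F h \<and> local_homeo h \<longrightarrow> h \<in> H)"

text \<open>
  The identity of the space is not added for free: it has to be obtained from \<open>E\<close> like any other
  map. Hence the domains of a symmetric set of generators cover the space.
\<close>
inductive_set generated :: "('a::topological_space \<rightharpoonup> 'a) set \<Rightarrow> ('a \<rightharpoonup> 'a) set"
  for E :: "('a \<rightharpoonup> 'a) set" where
  base: "h \<in> E \<Longrightarrow> h \<in> generated E"
| composition: "g \<in> generated E \<Longrightarrow> h \<in> generated E \<Longrightarrow> g \<circ>\<^sub>m h \<in> generated E"
| inversion: "h \<in> generated E \<Longrightarrow> map_inverse h \<in> generated E"
| restriction: "h \<in> generated E \<Longrightarrow> open U \<Longrightarrow> h |` U \<in> generated E"
| combination: "(\<And>f. f \<in> F \<Longrightarrow> f \<in> generated E) \<Longrightarrow> is_combination F h \<Longrightarrow> local_homeo h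
    \<Longrightarrow> h \<in> generated E"

definition generates :: "('a::topological_space \<rightharpoonup> 'a) set \<Rightarrow> ('a \<rightharpoonup> 'a) set \<Rightarrow> bool" where
  "generates E H \<longleftrightarrow> E \<subseteq> H \<and> H \<subseteq> generated E"

definition orbit :: "('a \<rightharpoonup> 'a) set \<Rightarrow> 'a \<Rightarrow> 'a set" where
  "orbit H x = {y. \<exists>h\<in>H. h x = Some y}"

definition pg_restriction :: "('a \<rightharpoonup> 'a) set \<Rightarrow> 'a set \<Rightarrow> ('a \<rightharpoonup> 'a) set" where
  "pg_restriction H U = {h \<in> H. dom h \<subseteq> U \<and> ran h \<subseteq> U}"

definition compactly_generated :: "('a::topological_space \<rightharpoonup> 'a) set \<Rightarrow> bool" where
  "compactly_generated H \<longleftrightarrow>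
     (\<exists>U. open U \<and> compact (closure U) \<and> (\<forall>x. orbit H x \<inter> U \<noteq> {}) \<and>
       (\<exists>E. finite E \<and> symmetric_maps E \<and> generates E (pg_restriction H U) \<and>
         (\<forall>g\<in>E. \<exists>g'\<in>H. closure (dom g) \<subseteq> dom g' \<and> g = g' |` dom g)))"


section \<open>Quasi-local metrics\<close>

text \<open>
  The conditions on a family of metric spaces only depend on which metric spaces occur in it, so
  families are sets of metrics. The function \<open>\<delta>\<close> is independent of the two spaces and the point, and
  the neighbourhood \<open>U\<close> is independent of \<open>\<epsilon>\<close>.
\<close>
definition quasi_locally_equal_cover :: "'a metric set \<Rightarrow> bool" where
  "quasi_locally_equal_cover D \<longleftrightarrow>
     (\<Union>m\<in>D. mspace m) = UNIV \<and>
     (\<forall>m\<in>D. \<forall>n\<in>D. openin (mtopology_of m) (mspace m \<inter> mspace n) \<and>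
                     openin (mtopology_of n) (mspace m \<inter> mspace n)) \<and>
     (\<exists>\<delta> :: real \<Rightarrow> real. (\<forall>\<epsilon>>0. \<delta> \<epsilon> > 0) \<and>
       (\<forall>m\<in>D. \<forall>n\<in>D. \<forall>z \<in> mspace m \<inter> mspace n.
         \<exists>U. z \<in> U \<and> U \<subseteq> mspace m \<inter> mspace n \<and>
             openin (mtopology_of m) U \<and> openin (mtopology_of n) U \<and>
             (\<forall>\<epsilon>>0. \<forall>x\<in>U. \<forall>y\<in>U. mdist m x y < \<delta> \<epsilon> \<longrightarrow> mdist n x y < \<epsilon>)))"

definition quasi_locally_equal_rel :: "('a metric set \<times> 'a metric set) set" where
  "quasi_locally_equal_rel = {(D, D'). quasi_locally_equal_cover D \<and>
     quasi_locally_equal_cover D' \<and> quasi_locally_equal_cover (D \<union> D')}"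

definition quasi_local_metrics :: "'a metric set set set" where
  "quasi_local_metrics = {D. quasi_locally_equal_cover D} // quasi_locally_equal_rel"

text \<open>Equivalent covers induce the same topology.\<close>
definition induces_topology :: "'a::topological_space metric set set \<Rightarrow> bool" where
  "induces_topology Q \<longleftrightarrow>
     (\<forall>D\<in>Q. topological_basis {mball_of m x r | m x r. m \<in> D \<and> x \<in> mspace m \<and> r > 0})"


section \<open>Strong equicontinuity and quasi-effectiveness\<close>

definition strong_equicontinuity_condition :: "('a::topological_space \<rightharpoonup> 'a) set \<Rightarrow> bool" where
  "strong_equicontinuity_condition S \<longleftrightarrow>
     (\<exists>Q \<in> quasi_local_metrics. induces_topology Q \<and>
       (\<exists>D\<in>Q. \<forall>\<epsilon>>0. \<exists>\<delta>>0. \<forall>h\<in>S. \<forall>m\<in>D. \<forall>n\<in>D. \<forall>x y x' y'.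
          x \<in> mspace m \<and> y \<in> mspace m \<and> h x = Some x' \<and> h y = Some y' \<and>
          x' \<in> mspace n \<and> y' \<in> mspace n \<and> mdist m x y < \<delta> \<longrightarrow> mdist n x' y' < \<epsilon>))"

definition strongly_equicontinuous :: "('a::topological_space \<rightharpoonup> 'a) set \<Rightarrow> bool" where
  "strongly_equicontinuous H \<longleftrightarrow>
     (\<exists>S. symmetric_maps S \<and> generates S H \<and> closed_under_composition S \<and>
          strong_equicontinuity_condition S)"

definition quasi_effectiveness_condition :: "('a::topological_space \<rightharpoonup> 'a) set \<Rightarrow> bool" where
  "quasi_effectiveness_condition S \<longleftrightarrow>
     (\<forall>h\<in>S. \<forall>U. open U \<and> U \<noteq> {} \<and> U \<subseteq> dom h \<and> (\<forall>x\<in>U. h x = Some x)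
        \<longrightarrow> (\<forall>x\<in>dom h. h x = Some x))"

definition quasi_effective :: "('a::topological_space \<rightharpoonup> 'a) set \<Rightarrow> bool" where
  "quasi_effective H \<longleftrightarrow>
     (\<exists>S. symmetric_maps S \<and> generates S H \<and> closed_under_composition S \<and>
          quasi_effectiveness_condition S)"

definition admissible_generators ::
    "('a::topological_space \<rightharpoonup> 'a) set \<Rightarrow> ('a \<rightharpoonup> 'a) set \<Rightarrow> bool" where
  "admissible_generators H S \<longleftrightarrow>
     symmetric_maps S \<and> generates S H \<and>
     closed_under_composition S \<and> closed_under_restriction S \<and>
     strong_equicontinuity_condition S \<and> quasi_effectiveness_condition S"


section \<open>The closure of a pseudogroup\<close>

text \<open>\<open>C(Y, Z)\<close>, where \<open>Z\<close> is the whole target type.\<close>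
definition cmaps :: "'a::topological_space set \<Rightarrow> ('a \<rightharpoonup> 'b::topological_space) set" where
  "cmaps Y = {h. dom h = Y \<and> continuous_on Y (\<lambda>x. the (h x))}"

text \<open>The subbasic sets with \<open>K = {}\<close> equal \<open>cmaps Y\<close>, so this is a topology on \<open>cmaps Y\<close>.\<close>
definition compact_open_topology ::
    "'a::topological_space set \<Rightarrow> ('a \<rightharpoonup> 'b::topological_space) topology" where
  "compact_open_topology Y = topology_generated_by
     {{h \<in> cmaps Y. (\<lambda>x. the (h x)) ` K \<subseteq> V} | K V. compact K \<and> K \<subseteq> Y \<and> open V}"

lemma topspace_compact_open_topology: "topspace (compact_open_topology Y) = cmaps Y"
  unfolding compact_open_topology_def topology_generated_by_topspace
  by (auto intro!: exI[of _ "{}::'a set"] exI[of _ "UNIV::'b set"] exI[of _ "cmaps Y"])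

text \<open>Continuity of the members follows from the closure being taken in \<open>C(O, Z)\<close>.\<close>
definition pg_tilde :: "('a::topological_space \<rightharpoonup> 'a) set \<Rightarrow> ('a \<rightharpoonup> 'a) set" where
  "pg_tilde S = {h. open (dom h) \<and>
     (\<forall>x\<in>dom h. \<exists>O'. open O' \<and> x \<in> O' \<and> O' \<subseteq> dom h \<and>
        h |` O' \<in> compact_open_topology O' closure_of (cmaps O' \<inter> S))}"

definition pg_bar :: "('a::topological_space \<rightharpoonup> 'a) set \<Rightarrow> ('a \<rightharpoonup> 'a) set" where
  "pg_bar S = {h \<in> pg_tilde S. local_homeo h}"

end

theory Submission
  imports Defs
begin

text \<open>
  Compact generation and strong equicontinuity give uniform domains: for \<open>p\<close>, \<open>q\<close> there is a
  radius \<open>\<rho>\<close> such that every generator taking a point near \<open>p\<close> to a point near \<open>q\<close> extends, with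
  the same germ there, to a generator defined on the whole \<open>\<rho>\<close>-ball around \<open>p\<close>. By
  quasi-effectiveness, the extension agrees with the original map wherever both are defined. Hence
  the inverses of maps in \<open>S\<close> converging to \<open>h\<close> near \<open>x\<close> live on a fixed ball around \<open>h x\<close> and are
  equicontinuous there, so \<open>h\<close> is a local homeomorphism whose local inverses are again limits of
  maps in \<open>S\<close>. If \<open>f\<^sub>n x\<close> converges to \<open>y\<close>, then the \<open>f\<^sub>n\<close> extend to a fixed ball around \<open>x\<close>, and a
  limit of them sends \<open>x\<close> to \<open>y\<close>; this gives the orbit closures. For independence, \<open>S \<inter> S'\<close> is
  again admissible, and extension by maps of \<open>S \<inter> S'\<close> shows that it has the same local limits as \<open>S\<close>.
\<close>

section \<open>Partial maps and local homeomorphisms\<close>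

text \<open>The obstacle is that maps in \<open>S\<close> may have arbitrarily small domains:
  convergence near \<open>x\<close> says nothing about where the inverses are defined, and those
  domains could shrink in the limit. Compact generation gives room only around the domain of each of
  finitely many generators, and a long composition would use up this room factor by factor. Strong
  equicontinuity stops the loss, but its condition speaks only of image points in a common metric
  space of the cover, so it is applied at a fixed scale, after the image is known to be small.
  Quasi-effectiveness acts like analytic continuation: an extension is built from one germ, yet has
  to agree with the original map at points that no connectedness argument links to that germ.

  Locally, compact-open limits are handled as uniform limits on small open sets, which local
  compactness permits. For the equicontinuity of the closure, local approximation is too weak, since
  the two points to be compared may be far apart; the generators chosen there are approximable on
  all compact subsets of their domains, together with their inverses.\<close>

abbreviation val :: "('a \<rightharpoonup> 'b) \<Rightarrow> 'a \<Rightarrow> 'b" where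
  "val h x \<equiv> the (h x)"

lemma val_Some: "x \<in> dom h \<Longrightarrow> h x = Some (val h x)"
  by auto

lemma ran_eq_val_image: "ran h = val h ` dom h"
  by (force simp: ran_def dom_def image_def)

lemma dom_map_comp: "dom (g \<circ>\<^sub>m h) = {x \<in> dom h. val h x \<in> dom g}"
  by (auto simp: map_comp_Some_iff)

lemma val_map_comp: "x \<in> dom h \<Longrightarrow> val (g \<circ>\<^sub>m h) x = val g (val h x)"
  by (auto simp: map_comp_def)

lemma val_restrict: "x \<in> U \<Longrightarrow> val (h |` U) x = val h x"
  by simp

lemma map_eqI_Some:
  assumes "\<And>x y. f x = Some y \<longleftrightarrow> g x = Some y"
  shows "f = g"
proof
  fix x show "f x = g x"
    by (metis assms not_Some_eq)
qed

lemma map_eqI_on_dom: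
  assumes "dom g = dom h" "\<And>x. x \<in> dom h \<Longrightarrow> val g x = val h x"
  shows "g = h"
proof
  fix x show "g x = h x"
  proof (cases "x \<in> dom h")
    case True
    then show ?thesis using val_Some[of x h] val_Some[of x g] assms by simp
  next
    case False
    then have "h x = None" "g x = None" using assms(1) by blast+
    then show ?thesis by simp
  qed
qed

lemma restrict_map_eqI:
  assumes "O' \<subseteq> dom g" "O' \<subseteq> dom h" "\<And>x. x \<in> O' \<Longrightarrow> val g x = val h x"
  shows "g |` O' = h |` O'"
  using assms by (intro map_eqI_on_dom) auto

lemma is_combination_iff:
  "is_combination F h \<longleftrightarrow> (\<forall>x y. h x = Some y \<longleftrightarrow> (\<exists>f\<in>F. f x = Some y))"
  unfolding is_combination_def Map.graph_def by (auto simp: set_eq_iff)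

text \<open>An injective, continuous, open map has a continuous inverse. As \<open>dom h\<close> and
  \<open>ran h\<close> are open in the space, relative and absolute openness agree, and the
  existential inverse gives way to conditions that pass directly to restrictions and
  compositions.\<close>

lemma local_homeo_iff:
  fixes h :: "'a::topological_space \<rightharpoonup> 'a"
  shows "local_homeo h \<longleftrightarrow> open (dom h) \<and> continuous_on (dom h) (val h) \<and> inj_on (val h) (dom h) \<and>
    (\<forall>V. open V \<longrightarrow> V \<subseteq> dom h \<longrightarrow> open (val h ` V))"
proof (intro iffI conjI allI impI)
  assume h: "local_homeo h"
  then obtain g where o: "open (dom h)" "open (ran h)" and g: "homeomorphism (dom h) (ran h) (val h) g"
    unfolding local_homeo_def by auto
  show "open (dom h)" "continuous_on (dom h) (val h)" using o g by (auto simp: homeomorphism_def)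
  show "inj_on (val h) (dom h)" using g by (metis homeomorphism_def inj_on_inverseI)
  fix V :: "'a set" assume V: "open V" "V \<subseteq> dom h"
  have "openin (top_of_set (ran h)) (val h ` V)"
    using homeomorphism_imp_open_map[OF g] V o by (simp add: open_subset)
  then show "open (val h ` V)" using o openin_open_eq by blast
next
  assume h: "open (dom h) \<and> continuous_on (dom h) (val h) \<and> inj_on (val h) (dom h) \<and>
    (\<forall>V. open V \<longrightarrow> V \<subseteq> dom h \<longrightarrow> open (val h ` V))"
  then have r: "open (ran h)" by (simp add: ran_eq_val_image)
  have "openin (top_of_set (ran h)) (val h ` V)" if "openin (top_of_set (dom h)) V" for V
    using that h r by (metis openin_open_eq open_subset ran_eq_val_image image_mono)
  then obtain g where "homeomorphism (dom h) (ran h) (val h) g"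
    using homeomorphism_injective_open_map[of "dom h" "val h" "ran h"] h ran_eq_val_image[of h] by metis
  then show "local_homeo h" unfolding local_homeo_def using h r by auto
qed

lemma local_homeoD:
  assumes "local_homeo h"
  shows "open (dom h)" "continuous_on (dom h) (val h)" "inj_on (val h) (dom h)"
    "\<And>V. open V \<Longrightarrow> V \<subseteq> dom h \<Longrightarrow> open (val h ` V)"
  using assms by (auto simp: local_homeo_iff)

lemma local_homeo_open_vimage:
  assumes "local_homeo h" "open V"
  shows "open {x \<in> dom h. val h x \<in> V}"
proof -
  have "open (val h -` V \<inter> dom h)"
    using assms local_homeoD by (metis continuous_on_open_vimage)
  moreover have "val h -` V \<inter> dom h = {x \<in> dom h. val h x \<in> V}" by auto
  ultimately show ?thesis by simp
qed

lemma local_homeo_restrict: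
  assumes "local_homeo h" "open U"
  shows "local_homeo (h |` U)"
  unfolding local_homeo_iff
proof (intro conjI allI impI)
  note h = local_homeoD[OF assms(1)]
  show "open (dom (h |` U))" using h assms by auto
  show "continuous_on (dom (h |` U)) (val (h |` U))"
    by (rule continuous_on_eq[of _ "val h"]) (auto intro: continuous_on_subset[OF h(2)])
  show "inj_on (val (h |` U)) (dom (h |` U))"
    using h(3) by (auto simp: inj_on_def)
  fix V assume V: "open V" "V \<subseteq> dom (h |` U)"
  then have "val (h |` U) ` V = val h ` V" by (intro image_cong) auto
  then show "open (val (h |` U) ` V)" using h(4)[of V] V by auto
qed

lemma local_homeo_comp:
  assumes g: "local_homeo g" and h: "local_homeo h"
  shows "local_homeo (g \<circ>\<^sub>m h)"
  unfolding local_homeo_iff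
proof (intro conjI allI impI)
  note gD = local_homeoD[OF g] and hD = local_homeoD[OF h]
  show "open (dom (g \<circ>\<^sub>m h))"
    using local_homeo_open_vimage[OF h gD(1)] by (simp add: dom_map_comp)
  have "continuous_on (dom (g \<circ>\<^sub>m h)) (val g \<circ> val h)"
    by (intro continuous_on_compose continuous_on_subset[OF hD(2)] continuous_on_subset[OF gD(2)])
       (auto simp: dom_map_comp)
  then show "continuous_on (dom (g \<circ>\<^sub>m h)) (val (g \<circ>\<^sub>m h))"
    by (rule continuous_on_eq) (auto simp: dom_map_comp val_map_comp)
  show "inj_on (val (g \<circ>\<^sub>m h)) (dom (g \<circ>\<^sub>m h))"
    using gD(3) hD(3) by (auto simp: inj_on_def dom_map_comp val_map_comp)
  fix V assume V: "open V" "V \<subseteq> dom (g \<circ>\<^sub>m h)"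
  then have "val (g \<circ>\<^sub>m h) ` V = val g ` (val h ` V)"
    unfolding image_image by (intro image_cong) (auto simp: dom_map_comp val_map_comp)
  moreover have "open (val g ` (val h ` V))"
    using V by (intro gD(4) hD(4)) (auto simp: dom_map_comp)
  ultimately show "open (val (g \<circ>\<^sub>m h) ` V)" by simp
qed

text \<open>Injectivity makes the description in \<open>map_inverse\<close> unique. In this form,
  identities between inverses become comparisons of graphs.\<close>

lemma map_inverse_Some_iff:
  assumes "inj_on (val h) (dom h)"
  shows "map_inverse h y = Some x \<longleftrightarrow> h x = Some y"
proof -
  have *: "x = x'" if "h x = Some y" "h x' = Some y" for x x'
    using inj_onD[OF assms, of x x'] that by auto
  have "(THE x. h x = Some y) = x" if "h x = Some y" for x
    using that * by blast
  then show ?thesis unfolding map_inverse_def ran_def by auto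
qed

lemma local_homeo_inverse_Some_iff:
  "local_homeo h \<Longrightarrow> map_inverse h y = Some x \<longleftrightarrow> h x = Some y"
  by (simp add: map_inverse_Some_iff local_homeoD)

lemma dom_map_inverse [simp]: "dom (map_inverse h) = ran h"
  by (auto simp: map_inverse_def split: if_splits)

lemma val_map_inverse:
  assumes "local_homeo h" "x \<in> dom h"
  shows "val (map_inverse h) (val h x) = x"
  using local_homeo_inverse_Some_iff[OF assms(1), of "val h x" x] assms by auto

lemma val_val_map_inverse:
  assumes "local_homeo h" "y \<in> ran h"
  shows "val (map_inverse h) y \<in> dom h" "val h (val (map_inverse h) y) = y"
proof -
  obtain x where "x \<in> dom h" "y = val h x"
    using assms(2) by (auto simp: ran_eq_val_image)
  then show "val (map_inverse h) y \<in> dom h" "val h (val (map_inverse h) y) = y"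
    by (simp_all add: val_map_inverse[OF assms(1)])
qed

lemma local_homeo_inverse:
  assumes h: "local_homeo h"
  shows "local_homeo (map_inverse h)"
  unfolding local_homeo_iff
proof (intro conjI allI impI)
  note hD = local_homeoD[OF h]
  show o: "open (dom (map_inverse h))" using hD by (simp add: ran_eq_val_image)
  obtain g where g: "homeomorphism (dom h) (ran h) (val h) g"
    using h unfolding local_homeo_def by auto
  show "continuous_on (dom (map_inverse h)) (val (map_inverse h))"
  proof (rule continuous_on_eq)
    show "continuous_on (dom (map_inverse h)) g" using g by (simp add: homeomorphism_def)
    fix y assume "y \<in> dom (map_inverse h)"
    then obtain x where x: "x \<in> dom h" "y = val h x" by (auto simp: ran_eq_val_image)
    then show "g y = val (map_inverse h) y"
      using g by (simp add: val_map_inverse[OF h] homeomorphism_def)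
  qed
  show "inj_on (val (map_inverse h)) (dom (map_inverse h))"
    by (rule inj_on_inverseI[of _ "val h"]) (simp add: val_val_map_inverse[OF h])
  fix V assume V: "open V" "V \<subseteq> dom (map_inverse h)"
  have "val (map_inverse h) ` V = {x \<in> dom h. val h x \<in> V}"
  proof
    show "val (map_inverse h) ` V \<subseteq> {x \<in> dom h. val h x \<in> V}"
      using V val_val_map_inverse[OF h] by auto
    show "{x \<in> dom h. val h x \<in> V} \<subseteq> val (map_inverse h) ` V"
      using val_map_inverse[OF h] by (force simp: image_iff)
  qed
  then show "open (val (map_inverse h) ` V)"
    using local_homeo_open_vimage[OF h V(1)] by simp
qed

lemma map_inverse_comp:
  assumes "local_homeo g" "local_homeo h"
  shows "map_inverse (g \<circ>\<^sub>m h) = map_inverse h \<circ>\<^sub>m map_inverse g"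
proof -
  have "map_inverse (g \<circ>\<^sub>m h) y = Some x \<longleftrightarrow> (map_inverse h \<circ>\<^sub>m map_inverse g) y = Some x" for x y
    by (auto simp: local_homeo_inverse_Some_iff assms local_homeo_comp map_comp_Some_iff)
  then show ?thesis by (rule map_eqI_Some)
qed

lemma map_inverse_map_inverse:
  assumes "local_homeo h"
  shows "map_inverse (map_inverse h) = h"
proof -
  have "map_inverse (map_inverse h) x = Some y \<longleftrightarrow> h x = Some y" for x y
    by (simp add: local_homeo_inverse_Some_iff assms local_homeo_inverse)
  then show ?thesis by (rule map_eqI_Some)
qed

lemma generated_local_homeo:
  assumes "\<And>h. h \<in> E \<Longrightarrow> local_homeo h" "f \<in> generated E"
  shows "local_homeo f"
  using assms(2)
  by induction (auto intro: assms(1) local_homeo_comp local_homeo_inverse local_homeo_restrict)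

section \<open>Germs of a generated pseudogroup\<close>

text \<open>There is no empty word: \<open>S\<close> need not contain \<open>Some\<close>, and words
  in \<open>S\<close> must again lie in \<open>S\<close>.\<close>

inductive_set words :: "('a \<rightharpoonup> 'a) set \<Rightarrow> ('a \<rightharpoonup> 'a) set" for E where
  single: "e \<in> E \<Longrightarrow> e \<in> words E"
| cons: "e \<in> E \<Longrightarrow> w \<in> words E \<Longrightarrow> e \<circ>\<^sub>m w \<in> words E"

lemma map_comp_assoc: "(f \<circ>\<^sub>m g) \<circ>\<^sub>m h = f \<circ>\<^sub>m (g \<circ>\<^sub>m h)"
  by (rule ext) (auto simp: map_comp_def split: option.split)

lemma words_comp: "v \<in> words E \<Longrightarrow> w \<in> words E \<Longrightarrow> v \<circ>\<^sub>m w \<in> words E"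
  by (induction rule: words.induct) (auto simp: map_comp_assoc intro: words.intros)

lemma words_local_homeo:
  assumes "\<And>h. h \<in> E \<Longrightarrow> local_homeo h" "w \<in> words E"
  shows "local_homeo w"
  using assms(2) by induction (auto intro: assms(1) local_homeo_comp)

lemma words_inverse:
  assumes "\<And>h. h \<in> E \<Longrightarrow> local_homeo h" "symmetric_maps E" "w \<in> words E"
  shows "map_inverse w \<in> words E"
  using assms(3)
proof induction
  case (single e)
  then show ?case using assms(2) by (auto simp: symmetric_maps_def intro: words.intros)
next
  case (cons e w)
  have "map_inverse e \<in> words E"
    using cons.hyps assms(2) by (auto simp: symmetric_maps_def intro: words.intros)
  then show ?case
    using cons words_comp by (metis assms(1) map_inverse_comp words_local_homeo)
qed

lemma words_subset: "w \<in> words S \<Longrightarrow> closed_under_composition S \<Longrightarrow> w \<in> S"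
  by (induction rule: words.induct) (auto simp: closed_under_composition_def)

text \<open>Equality of germs at \<open>x\<close>. Containment of \<open>U\<close> in both domains
  excludes agreement through the value \<open>None\<close>.\<close>

definition agree_near :: "'a::topological_space \<Rightarrow> ('a \<rightharpoonup> 'b) \<Rightarrow> ('a \<rightharpoonup> 'b) \<Rightarrow> bool" where
  "agree_near x f g \<longleftrightarrow> (\<exists>U. open U \<and> x \<in> U \<and> U \<subseteq> dom f \<and> U \<subseteq> dom g \<and> (\<forall>y\<in>U. f y = g y))"

lemma agree_near_comp:
  assumes h: "local_homeo h" and gg: "agree_near (val h x) g g'" and hh: "agree_near x h h'"
  shows "agree_near x (g \<circ>\<^sub>m h) (g' \<circ>\<^sub>m h')"
proof -
  obtain V where V: "open V" "val h x \<in> V" "V \<subseteq> dom g" "V \<subseteq> dom g'" "\<forall>y\<in>V. g y = g' y"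
    using gg unfolding agree_near_def by blast
  obtain U where U: "open U" "x \<in> U" "U \<subseteq> dom h" "U \<subseteq> dom h'" "\<forall>y\<in>U. h y = h' y"
    using hh unfolding agree_near_def by blast
  let ?W = "U \<inter> {x \<in> dom h. val h x \<in> V}"
  have "open ?W" using U V local_homeo_open_vimage[OF h] by auto
  moreover have "x \<in> ?W" using U V by auto
  moreover have "?W \<subseteq> dom (g \<circ>\<^sub>m h)" using V by (auto simp: dom_map_comp)
  moreover have eq: "\<forall>y\<in>?W. (g \<circ>\<^sub>m h) y = (g' \<circ>\<^sub>m h') y"
  proof
    fix y assume y: "y \<in> ?W"
    then obtain z where z: "h y = Some z" by auto
    moreover have "h' y = Some z" using y z U(5) by auto
    moreover have "g z = g' z" using y z V(5) by auto
    ultimately show "(g \<circ>\<^sub>m h) y = (g' \<circ>\<^sub>m h') y" by (simp add: map_comp_def)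
  qed
  ultimately show ?thesis
    unfolding agree_near_def by (intro exI[of _ ?W]) (auto simp: domIff subset_iff)
qed

lemma agree_near_inverse:
  assumes h: "local_homeo h" and w: "local_homeo w" and hw: "agree_near x h w"
  shows "agree_near (val h x) (map_inverse h) (map_inverse w)"
proof -
  obtain U where U: "open U" "x \<in> U" "U \<subseteq> dom h" "U \<subseteq> dom w" "\<forall>y\<in>U. h y = w y"
    using hw unfolding agree_near_def by blast
  have eq: "map_inverse h y = Some z \<and> map_inverse w y = Some z" if "y = val h z" "z \<in> U" for y z
  proof -
    have "h z = Some y" using that U(3) val_Some[of z h] by auto
    moreover have "w z = Some y" using calculation that(2) U(5) by simp
    ultimately show ?thesis by (simp add: local_homeo_inverse_Some_iff h w)
  qed
  show ?thesis
    unfolding agree_near_def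
    using local_homeoD(4)[OF h U(1,3)] U(2) eq
    by (intro exI[of _ "val h ` U"]) fastforce
qed

text \<open>Restriction and combination leave the germ at a point unchanged, germs of words compose
  to germs of words, and inverses of words are words because \<open>E\<close> is symmetric.\<close>

lemma generated_germ_word:
  assumes E: "\<And>h. h \<in> E \<Longrightarrow> local_homeo h" "symmetric_maps E"
    and f: "f \<in> generated E" "x \<in> dom f"
  shows "\<exists>w \<in> words E. agree_near x f w"
  using f
proof (induction arbitrary: x)
  case (base h)
  then show ?case using local_homeoD(1)[OF E(1)] unfolding agree_near_def
    by (intro bexI[of _ h]) (auto intro: words.intros)
next
  case (composition g h)
  have hx: "x \<in> dom h" "val h x \<in> dom g" using composition.prems by (auto simp: dom_map_comp)
  obtain v w where "v \<in> words E" "agree_near (val h x) g v" "w \<in> words E" "agree_near x h w"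
    using composition.IH(1)[OF hx(2)] composition.IH(2)[OF hx(1)] by blast
  then show ?case
    using agree_near_comp generated_local_homeo[OF E(1) composition.hyps(2)] words_comp by metis
next
  case (inversion h)
  have h: "local_homeo h" using generated_local_homeo[OF E(1) inversion.hyps] .
  obtain z where z: "z \<in> dom h" "x = val h z"
    using inversion.prems by (auto simp: ran_eq_val_image)
  obtain w where "w \<in> words E" "agree_near z h w" using inversion.IH z by blast
  then show ?case
    using agree_near_inverse[OF h] words_local_homeo[OF E(1)] words_inverse[OF E] z by metis
next
  case (restriction h U)
  then have "x \<in> dom h" by auto
  then obtain w V where w: "w \<in> words E" "open V" "x \<in> V" "V \<subseteq> dom h" "V \<subseteq> dom w" "\<forall>y\<in>V. h y = w y"
    using restriction.IH unfolding agree_near_def by blast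
  then show ?case using restriction unfolding agree_near_def
    by (intro bexI[of _ w] exI[of _ "V \<inter> U"]) auto
next
  case (combination F h)
  then obtain f where f: "f \<in> F" "x \<in> dom f" unfolding is_combination_iff by (metis domD domI)
  then obtain w V where w: "w \<in> words E" "open V" "x \<in> V" "V \<subseteq> dom f" "V \<subseteq> dom w" "\<forall>y\<in>V. f y = w y"
    using combination.IH[OF f] unfolding agree_near_def by blast
  have "h y = f y" if "y \<in> V" for y
    using that w(4) combination.hyps(2) f unfolding is_combination_iff by (metis domD subsetD)
  then show ?case using w unfolding agree_near_def
    by (intro bexI[of _ w] exI[of _ V]) (auto simp: domIff subset_iff)
qed

text \<open>The map is the combination of those of its own restrictions that lie in
  \<open>E\<close>.\<close>

lemma generated_of_germs:
  assumes h: "local_homeo h"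
    and loc: "\<And>x. x \<in> dom h \<Longrightarrow> \<exists>O'. open O' \<and> x \<in> O' \<and> h |` O' \<in> E"
  shows "h \<in> generated E"
proof -
  let ?F = "{h |` O' | O'. open O' \<and> h |` O' \<in> E}"
  have "is_combination ?F h"
    unfolding is_combination_iff
  proof (intro allI iffI)
    fix x y assume xy: "h x = Some y"
    then obtain O' where "open O'" "x \<in> O'" "h |` O' \<in> E" using loc by blast
    then show "\<exists>f\<in>?F. f x = Some y" using xy by (intro bexI[of _ "h |` O'"]) auto
  next
    fix x y assume "\<exists>f\<in>?F. f x = Some y"
    then show "h x = Some y" by (auto simp: restrict_map_def split: if_splits)
  qed
  then show ?thesis
    by (rule generated.combination[rotated]) (use h in \<open>auto intro: generated.base\<close>)
qed

section \<open>Equicontinuity on compact sets\<close>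

text \<open>Closed balls need not be compact in general; a small one is, being a closed subset of a
  compact neighbourhood.\<close>

lemma locally_compact_cball:
  fixes x :: "'a::metric_space"
  assumes "locally compact (UNIV :: 'a set)" "open V" "x \<in> V"
  obtains r where "r > 0" "compact (cball x r)" "cball x r \<subseteq> V"
proof -
  obtain u v where uv: "open u" "compact v" "x \<in> u" "u \<subseteq> v" "v \<subseteq> V"
    using locallyE[OF assms(1), of V x] assms(2,3) by auto
  obtain r where r: "r > 0" "cball x r \<subseteq> u"
    using open_contains_cball uv by blast
  have "compact (v \<inter> cball x r)" using uv by (intro compact_Int_closed) auto
  moreover have "v \<inter> cball x r = cball x r" using r uv by auto
  ultimately show ?thesis using that[of r] r uv by auto
qed

lemma finite_uniform_radius:
  fixes P :: "'b \<Rightarrow> real \<Rightarrow> bool"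
  assumes "finite F" "\<And>z. z \<in> F \<Longrightarrow> \<exists>d>0. P z d"
    and mono: "\<And>z d d'. P z d \<Longrightarrow> 0 < d' \<Longrightarrow> d' \<le> d \<Longrightarrow> P z d'"
  shows "\<exists>d>0. \<forall>z\<in>F. P z d"
  using assms(1,2)
proof (induction F)
  case empty
  then show ?case by (auto intro: exI[of _ 1])
next
  case (insert a F)
  obtain d where d: "d > 0" "\<forall>z\<in>F. P z d" using insert by auto
  obtain d' where d': "d' > 0" "P a d'" using insert by auto
  show ?case using d d' mono[of _ d "min d d'"] mono[of a d' "min d d'"]
    by (intro exI[of _ "min d d'"]) auto
qed

lemma compact_positive_lower_bound:
  fixes g :: "'a::metric_space \<Rightarrow> real"
  assumes "compact A" "continuous_on A g" "\<And>p. p \<in> A \<Longrightarrow> g p > 0"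
  shows "\<exists>d>0. \<forall>p\<in>A. d \<le> g p"
proof (cases "A = {}")
  case False
  then obtain p where "p \<in> A" "\<forall>q\<in>A. g p \<le> g q" using continuous_attains_inf assms by metis
  then show ?thesis using assms(3) by blast
qed (auto intro: exI[of _ 1])

section \<open>Comparison of a metric of the cover with the ambient distance\<close>

lemma mdist_same [simp]: "x \<in> mspace m \<Longrightarrow> mdist m x x = 0"
  by simp

lemma centre_in_mball_of: "x \<in> mspace m \<Longrightarrow> r > 0 \<Longrightarrow> x \<in> mball_of m x r"
  by simp

text \<open>Openness of the \<open>m\<close>-balls makes \<open>mdist m\<close> continuous on the
  square of \<open>C\<close>. The pairs at distance at least \<open>e\<close> for one metric form a
  compact set that misses the diagonal, so the other distance has a positive lower bound there.
  Compactness thus yields both directions from openness of the balls of one metric.\<close>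

lemma compact_metric_comparison:
  fixes C :: "'a::metric_space set"
  assumes C: "compact C" "C \<subseteq> mspace m"
    and balls: "\<And>x r. x \<in> mspace m \<Longrightarrow> r > 0 \<Longrightarrow> open (mball_of m x r)"
    and "e > 0"
  shows "\<exists>d>0. \<forall>x\<in>C. \<forall>y\<in>C. (dist x y < d \<longrightarrow> mdist m x y < e) \<and> (mdist m x y < d \<longrightarrow> dist x y < e)"
proof -
  define f where "f = (\<lambda>p. mdist m (fst p) (snd p))"
  have cont: "continuous_on (C \<times> C) f"
    unfolding continuous_on_iff
  proof (intro ballI allI impI)
    fix p and \<epsilon> :: real assume p: "p \<in> C \<times> C" and \<epsilon>: "\<epsilon> > 0"
    obtain x y where xy: "p = (x, y)" "x \<in> C" "y \<in> C" using p by auto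
    have near: "\<exists>d>0. ball z d \<subseteq> mball_of m z (\<epsilon>/2)" if "z \<in> C" for z
    proof -
      have "z \<in> mspace m" using that C by auto
      then have "open (mball_of m z (\<epsilon>/2))" "z \<in> mball_of m z (\<epsilon>/2)"
        using balls \<epsilon> by (auto intro: centre_in_mball_of)
      then show ?thesis by (meson openE)
    qed
    obtain d where d: "d > 0" "ball x d \<subseteq> mball_of m x (\<epsilon>/2)" using near xy by blast
    obtain d' where d': "d' > 0" "ball y d' \<subseteq> mball_of m y (\<epsilon>/2)" using near xy by blast
    have "dist (f q) (f p) < \<epsilon>" if q: "q \<in> C \<times> C" "dist q p < min d d'" for q
    proof -
      obtain x' y' where q': "q = (x', y')" "x' \<in> C" "y' \<in> C" using q by auto
      have "dist x' x < d" "dist y' y < d'"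
        using dist_fst_le[of q p] dist_snd_le[of q p] q q' xy by auto
      then have 1: "mdist m x x' < \<epsilon>/2" "mdist m y y' < \<epsilon>/2"
        using d d' by (auto simp: dist_commute subset_iff)
      have mem: "x \<in> mspace m" "y \<in> mspace m" "x' \<in> mspace m" "y' \<in> mspace m" using xy q' C by auto
      have "mdist m x y \<le> mdist m x x' + mdist m x' y" "mdist m x' y \<le> mdist m x' y' + mdist m y' y"
        "mdist m x' y' \<le> mdist m x' x + mdist m x y'" "mdist m x y' \<le> mdist m x y + mdist m y y'"
        using mem by (auto intro: mdist_triangle)
      then show ?thesis
        using 1 unfolding f_def xy q' by (auto simp: dist_real_def mdist_commute)
    qed
    then show "\<exists>d>0. \<forall>q\<in>C \<times> C. dist q p < d \<longrightarrow> dist (f q) (f p) < \<epsilon>"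
      using d d' by (intro exI[of _ "min d d'"]) auto
  qed
  have CC: "compact (C \<times> C)" "closed (C \<times> C)"
    using C(1) by (auto intro: compact_Times compact_imp_closed)
  have conv_d: "continuous_on (C \<times> C) (\<lambda>p. dist (fst p) (snd p))"
    by (intro continuous_intros)
  have cA: "compact {p \<in> C \<times> C. e \<le> g p}" if "continuous_on (C \<times> C) g" for g
  proof -
    have "closed {p \<in> C \<times> C. e \<le> g p}"
      using CC(2) that by (intro continuous_on_closed_Collect_le) auto
    then have "compact ((C \<times> C) \<inter> {p \<in> C \<times> C. e \<le> g p})" using CC(1) by (rule compact_Int_closed[rotated])
    moreover have "(C \<times> C) \<inter> {p \<in> C \<times> C. e \<le> g p} = {p \<in> C \<times> C. e \<le> g p}" by auto
    ultimately show ?thesis by simp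
  qed
  have "\<exists>d>0. \<forall>p\<in>{p \<in> C \<times> C. e \<le> f p}. d \<le> dist (fst p) (snd p)"
  proof (rule compact_positive_lower_bound[OF cA[OF cont] continuous_on_subset[OF conv_d]])
    fix p assume "p \<in> {p \<in> C \<times> C. e \<le> f p}"
    then have "fst p \<noteq> snd p" using C(2) \<open>e > 0\<close> by (auto simp: f_def)
    then show "dist (fst p) (snd p) > 0" by simp
  qed auto
  moreover have "\<exists>d>0. \<forall>p\<in>{p \<in> C \<times> C. e \<le> dist (fst p) (snd p)}. d \<le> f p"
  proof (rule compact_positive_lower_bound[OF cA[OF conv_d] continuous_on_subset[OF cont]])
    fix p assume "p \<in> {p \<in> C \<times> C. e \<le> dist (fst p) (snd p)}"
    then have "fst p \<noteq> snd p" "fst p \<in> mspace m" "snd p \<in> mspace m" using C(2) \<open>e > 0\<close> by auto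
    then show "f p > 0"
      unfolding f_def by (metis mdist_nonneg mdist_zero order_le_less)
  qed auto
  ultimately obtain d d' where d:
    "d > 0" "\<forall>x\<in>C. \<forall>y\<in>C. e \<le> mdist m x y \<longrightarrow> d \<le> dist x y"
    "d' > 0" "\<forall>x\<in>C. \<forall>y\<in>C. e \<le> dist x y \<longrightarrow> d' \<le> mdist m x y"
    by (auto simp: f_def)
  have "(dist x y < min d d' \<longrightarrow> mdist m x y < e) \<and> (mdist m x y < min d d' \<longrightarrow> dist x y < e)"
    if "x \<in> C" "y \<in> C" for x y
    using d(2,4) that by (meson min_less_iff_conj not_le)
  then show ?thesis using d(1,3) by (intro exI[of _ "min d d'"]) simp
qed

section \<open>From quasi-local metrics to equicontinuity for the ambient distance\<close>

definition open_metric_cover :: "'a::topological_space metric set \<Rightarrow> bool" where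
  "open_metric_cover D \<longleftrightarrow> (\<Union>m\<in>D. mspace m) = UNIV \<and>
     (\<forall>m\<in>D. \<forall>x\<in>mspace m. \<forall>r>0. open (mball_of m x r))"

text \<open>The inner part of \<open>strong_equicontinuity_condition\<close> for one fixed cover;
  separating it lets the same cover serve other sets of maps, such as \<open>S \<inter> S'\<close>
  and the generators of the closure.\<close>

definition equicontinuous_wrt :: "'a metric set \<Rightarrow> ('a::topological_space \<rightharpoonup> 'a) set \<Rightarrow> bool" where
  "equicontinuous_wrt D S \<longleftrightarrow> (\<forall>\<epsilon>>0. \<exists>\<delta>>0. \<forall>h\<in>S. \<forall>m\<in>D. \<forall>n\<in>D. \<forall>x y x' y'.
     x \<in> mspace m \<and> y \<in> mspace m \<and> h x = Some x' \<and> h y = Some y' \<and>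
     x' \<in> mspace n \<and> y' \<in> mspace n \<and> mdist m x y < \<delta> \<longrightarrow> mdist n x' y' < \<epsilon>)"

lemma quasi_local_metric_cover:
  assumes "Q \<in> quasi_local_metrics" "induces_topology Q" "D \<in> Q"
  shows "open_metric_cover D"
proof -
  obtain D' where D': "Q = quasi_locally_equal_rel `` {D'}"
    using assms(1) unfolding quasi_local_metrics_def by (auto elim: quotientE)
  then have "quasi_locally_equal_cover D" using assms(3) by (auto simp: quasi_locally_equal_rel_def)
  then have "(\<Union>m\<in>D. mspace m) = UNIV" by (simp add: quasi_locally_equal_cover_def)
  moreover have "topological_basis {mball_of m x r | m x r. m \<in> D \<and> x \<in> mspace m \<and> r > 0}"
    using assms by (auto simp: induces_topology_def)
  then have "\<forall>m\<in>D. \<forall>x\<in>mspace m. \<forall>r>0. open (mball_of m x r)"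
    by (auto intro: topological_basis_open)
  ultimately show ?thesis by (simp add: open_metric_cover_def)
qed

lemma open_metric_cover_mspace_open:
  assumes "open_metric_cover D" "m \<in> D"
  shows "open (mspace m)"
proof -
  have "mspace m = (\<Union>x\<in>mspace m. mball_of m x 1)" using centre_in_mball_of[of _ m 1] by force
  also have "open \<dots>" using assms by (intro open_UN) (auto simp: open_metric_cover_def)
  finally show ?thesis .
qed

lemma strong_equicontinuity_condition_alt:
  "strong_equicontinuity_condition S \<longleftrightarrow>
     (\<exists>Q\<in>quasi_local_metrics. induces_topology Q \<and> (\<exists>D\<in>Q. equicontinuous_wrt D S))"
  unfolding strong_equicontinuity_condition_def equicontinuous_wrt_def ..

definition equicontinuous_at_scale ::
    "('a::metric_space \<rightharpoonup> 'a) set \<Rightarrow> 'a set \<Rightarrow> real \<Rightarrow> bool" where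
  "equicontinuous_at_scale S K l \<longleftrightarrow> (\<forall>e>0. \<exists>d>0. \<forall>h\<in>S. \<forall>p\<in>K. \<forall>q\<in>K.
     \<forall>y\<in>dom h \<inter> ball p l. \<forall>y'\<in>dom h \<inter> ball p l.
       val h y \<in> ball q l \<longrightarrow> val h y' \<in> ball q l \<longrightarrow> dist y y' < d \<longrightarrow> dist (val h y) (val h y') < e)"

text \<open>
  The scale \<open>l\<close> cannot be dropped: the condition on quasi-local metrics does not restrict the images
  of nearby points that lie in no common metric space of the cover.
\<close>
lemma equicontinuous_wrt_imp_at_scale:
  fixes S :: "('a::metric_space \<rightharpoonup> 'a) set"
  assumes lc: "locally compact (UNIV :: 'a set)"
    and D: "open_metric_cover D" "equicontinuous_wrt D S" and K: "compact K"
  shows "\<exists>l>0. equicontinuous_at_scale S K l"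
proof -
  have "\<exists>m r. m \<in> D \<and> r > 0 \<and> compact (cball z r) \<and> cball z r \<subseteq> mspace m" for z
  proof -
    obtain m where m: "m \<in> D" "z \<in> mspace m" using D(1) unfolding open_metric_cover_def by blast
    then show ?thesis
      using locally_compact_cball[OF lc open_metric_cover_mspace_open[OF D(1) m(1)] m(2)] by metis
  qed
  then obtain m r where mr: "\<And>z. m z \<in> D" "\<And>z. r z > 0" "\<And>z. compact (cball z (r z))"
    "\<And>z. cball z (r z) \<subseteq> mspace (m z)"
    by metis
  have cover: "K \<subseteq> (\<Union>z\<in>K. ball z (r z / 2))" using mr(2) by force
  obtain F where F: "F \<subseteq> K" "finite F" "K \<subseteq> (\<Union>z\<in>F. ball z (r z / 2))"
    by (rule compactE_image[OF K open_ball cover])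
  have "\<exists>l>0. \<forall>z\<in>F. l \<le> r z / 2"
  proof (rule finite_uniform_radius[OF F(2)])
    fix z show "\<exists>d>0. d \<le> r z / 2" using mr(2)[of z] by (intro exI[of _ "r z / 2"]) simp
  qed simp
  then obtain l where l: "l > 0" "\<forall>z\<in>F. l \<le> r z / 2" by blast
  \<comment> \<open>Half radii act as a Lebesgue number: every \<open>ball p l\<close> with centre
    in \<open>K\<close> lies in one compact ball inside one metric space of the cover, where the two
    distances are comparable.\<close>
  have sub: "\<exists>z\<in>F. ball p l \<subseteq> cball z (r z)" if p: "p \<in> K" for p
  proof -
    obtain z where z: "z \<in> F" "dist z p < r z / 2" using F(3) p by auto
    have "ball p l \<subseteq> cball z (r z)"
    proof
      fix y assume "y \<in> ball p l"
      then have "dist z y < r z" using z l dist_triangle[of z y p] by fastforce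
      then show "y \<in> cball z (r z)" by simp
    qed
    then show ?thesis using z by blast
  qed
  have comp: "\<exists>d>0. \<forall>z\<in>F. \<forall>x\<in>cball z (r z). \<forall>y\<in>cball z (r z).
      (dist x y < d \<longrightarrow> mdist (m z) x y < e) \<and> (mdist (m z) x y < d \<longrightarrow> dist x y < e)"
    if "e > 0" for e
  proof (rule finite_uniform_radius[OF F(2)])
    fix z
    show "\<exists>d>0. \<forall>x\<in>cball z (r z). \<forall>y\<in>cball z (r z).
      (dist x y < d \<longrightarrow> mdist (m z) x y < e) \<and> (mdist (m z) x y < d \<longrightarrow> dist x y < e)"
      using compact_metric_comparison[OF mr(3)[of z] mr(4)[of z] _ that] D(1) mr(1)
      unfolding open_metric_cover_def by auto
  qed fastforce
  have "equicontinuous_at_scale S K l"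
    unfolding equicontinuous_at_scale_def
  proof (intro allI impI)
    fix e :: real assume "e > 0"
    \<comment> \<open>Tolerances are chosen backwards: \<open>e\<close> for \<open>dist\<close> of
      the images, \<open>d1\<close> for the cover metric of the images, \<open>\<delta>\<close> for
      the cover metric of the sources, and \<open>d\<close> for \<open>dist\<close> of the
      sources.\<close>
    from comp[OF this] obtain d1 where d1: "d1 > 0" "\<And>z x y. z \<in> F \<Longrightarrow> x \<in> cball z (r z) \<Longrightarrow>
      y \<in> cball z (r z) \<Longrightarrow> mdist (m z) x y < d1 \<Longrightarrow> dist x y < e"
      by (elim exE conjE) metis
    obtain \<delta> where \<delta>: "\<delta> > 0" "\<forall>h\<in>S. \<forall>m\<in>D. \<forall>n\<in>D. \<forall>x y x' y'.
     x \<in> mspace m \<and> y \<in> mspace m \<and> h x = Some x' \<and> h y = Some y' \<and>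
     x' \<in> mspace n \<and> y' \<in> mspace n \<and> mdist m x y < \<delta> \<longrightarrow> mdist n x' y' < d1"
      using D(2) d1(1) unfolding equicontinuous_wrt_def by blast
    from comp[OF \<delta>(1)] obtain d where d: "d > 0" "\<And>z x y. z \<in> F \<Longrightarrow> x \<in> cball z (r z) \<Longrightarrow>
      y \<in> cball z (r z) \<Longrightarrow> dist x y < d \<Longrightarrow> mdist (m z) x y < \<delta>"
      by (elim exE conjE) metis
    show "\<exists>d>0. \<forall>h\<in>S. \<forall>p\<in>K. \<forall>q\<in>K. \<forall>y\<in>dom h \<inter> ball p l. \<forall>y'\<in>dom h \<inter> ball p l.
       val h y \<in> ball q l \<longrightarrow> val h y' \<in> ball q l \<longrightarrow> dist y y' < d \<longrightarrow> dist (val h y) (val h y') < e"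
    proof (intro exI[of _ d] conjI d(1) ballI impI)
      fix h p q y y'
      assume h: "h \<in> S" and pq: "p \<in> K" "q \<in> K"
        and y: "y \<in> dom h \<inter> ball p l" "y' \<in> dom h \<inter> ball p l"
        and hy: "val h y \<in> ball q l" "val h y' \<in> ball q l" and dd: "dist y y' < d"
      obtain z where z: "z \<in> F" "ball p l \<subseteq> cball z (r z)" using sub pq by blast
      obtain z' where z': "z' \<in> F" "ball q l \<subseteq> cball z' (r z')" using sub pq by blast
      have Y: "y \<in> cball z (r z)" "y' \<in> cball z (r z)" "val h y \<in> cball z' (r z')" "val h y' \<in> cball z' (r z')"
        using z z' y hy by auto
      then have "mdist (m z) y y' < \<delta>" using d(2)[OF z(1)] dd by simp
      moreover have "y \<in> mspace (m z)" "y' \<in> mspace (m z)"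
        "val h y \<in> mspace (m z')" "val h y' \<in> mspace (m z')"
        using Y mr(4)[of z] mr(4)[of z'] by auto
      moreover have "h y = Some (val h y)" "h y' = Some (val h y')" using y by auto
      ultimately have "mdist (m z') (val h y) (val h y') < d1"
        using \<delta>(2) h mr(1) by blast
      then show "dist (val h y) (val h y') < e" using d1(2)[OF z'(1)] Y by simp
    qed
  qed
  then show ?thesis using l(1) by blast
qed

lemma strong_equicontinuity_at_scale:
  fixes S :: "('a::metric_space \<rightharpoonup> 'a) set"
  assumes "locally compact (UNIV :: 'a set)" "strong_equicontinuity_condition S" "compact K"
  shows "\<exists>l>0. equicontinuous_at_scale S K l"
  using assms equicontinuous_wrt_imp_at_scale quasi_local_metric_cover
  unfolding strong_equicontinuity_condition_alt by blast

section \<open>Extension of maps to uniform domains\<close>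

lemma agree_near_trans:
  assumes "agree_near x f g" "agree_near x g h"
  shows "agree_near x f h"
proof -
  obtain U V where "open U" "x \<in> U" "U \<subseteq> dom f" "\<forall>y\<in>U. f y = g y"
    and "open V" "x \<in> V" "V \<subseteq> dom h" "\<forall>y\<in>V. g y = h y"
    using assms unfolding agree_near_def by blast
  moreover from this have "\<forall>y\<in>U \<inter> V. f y = h y" by simp
  ultimately show ?thesis unfolding agree_near_def
    by (metis open_Int IntI le_infI1 le_infI2)
qed

lemma agree_near_refl: "open (dom f) \<Longrightarrow> x \<in> dom f \<Longrightarrow> agree_near x f f"
  unfolding agree_near_def by blast

lemma agree_near_restrict:
  "open U \<Longrightarrow> x \<in> U \<Longrightarrow> open (dom f) \<Longrightarrow> x \<in> dom f \<Longrightarrow> agree_near x f (f |` U)"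
  unfolding agree_near_def by (intro exI[of _ "U \<inter> dom f"]) auto

lemma agree_nearD: "agree_near x f g \<Longrightarrow> x \<in> dom f \<and> x \<in> dom g \<and> f x = g x"
  unfolding agree_near_def by blast

text \<open>\<open>S\<close> is a parameter so that independence can interpret the results for a
  second set of generators and for a smaller one.\<close>

locale admissible_pseudogroup =
  fixes H S :: "('a::polish_space \<rightharpoonup> 'a) set"
  assumes locally_compact: "locally compact (UNIV :: 'a set)"
    and pseudogroup: "pseudogroup H"
    and compactly_generated: "compactly_generated H"
    and admissible: "admissible_generators H S"
begin

section \<open>Germs and rigidity of admissible generators\<close>

lemma H_local_homeo: "h \<in> H \<Longrightarrow> local_homeo h"
  using pseudogroup by (simp add: pseudogroup_def)

lemma S_subset_H: "S \<subseteq> H"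
  using admissible by (simp add: admissible_generators_def generates_def)

lemma S_local_homeo: "h \<in> S \<Longrightarrow> local_homeo h"
  using S_subset_H H_local_homeo by blast

lemma S_dom_open: "h \<in> S \<Longrightarrow> open (dom h)"
  by (simp add: S_local_homeo local_homeoD)

lemma S_comp: "g \<in> S \<Longrightarrow> h \<in> S \<Longrightarrow> g \<circ>\<^sub>m h \<in> S"
  and S_inverse: "h \<in> S \<Longrightarrow> map_inverse h \<in> S"
  and S_restrict: "h \<in> S \<Longrightarrow> open U \<Longrightarrow> h |` U \<in> S"
  using admissible by (auto simp: admissible_generators_def closed_under_composition_def
      symmetric_maps_def closed_under_restriction_def)

text \<open>A germ of \<open>H\<close> is the germ of a word in \<open>S\<close>, hence of a member
  of \<open>S\<close>; closure under restriction then puts the restricted map itself into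
  \<open>S\<close>.\<close>

lemma H_germ:
  assumes "h \<in> H" "x \<in> dom h"
  obtains O' where "open O'" "x \<in> O'" "O' \<subseteq> dom h" "h |` O' \<in> S"
proof -
  have "h \<in> generated S"
    using assms admissible by (auto simp: admissible_generators_def generates_def)
  moreover have "symmetric_maps S" "closed_under_composition S"
    using admissible by (auto simp: admissible_generators_def)
  ultimately obtain w where w: "w \<in> S" "agree_near x h w"
    using generated_germ_word S_local_homeo assms(2) words_subset by metis
  then obtain U where U: "open U" "x \<in> U" "U \<subseteq> dom h" "U \<subseteq> dom w" "\<forall>y\<in>U. h y = w y"
    unfolding agree_near_def by blast
  then have "h |` U = w |` U" by (intro restrict_map_eqI) auto
  then show ?thesis using that[of U] U S_restrict[OF w(1)] by simp
qed

text \<open>The map \<open>g \<circ>\<^sub>m map_inverse g'\<close> lies in \<open>S\<close> and is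
  the identity on a non-empty open set. Quasi-effectiveness makes it the identity on its whole
  domain, which contains \<open>val g' z\<close>.\<close>

lemma S_agree:
  assumes g: "g \<in> S" and g': "g' \<in> S" and x: "agree_near x g g'"
    and z: "z \<in> dom g" "z \<in> dom g'"
  shows "g z = g' z"
proof -
  obtain U where U: "open U" "x \<in> U" "U \<subseteq> dom g" "U \<subseteq> dom g'" "\<forall>y\<in>U. g y = g' y"
    using x unfolding agree_near_def by blast
  define k where "k = g \<circ>\<^sub>m map_inverse g'"
  have k: "k (val g' y) = g y" if "y \<in> dom g'" for y
  proof -
    have "map_inverse g' (val g' y) = Some y"
      using that by (auto simp: local_homeo_inverse_Some_iff S_local_homeo[OF g'])
    then show ?thesis by (simp add: k_def map_comp_def)
  qed
  have k_id: "k y = Some y" if y: "y \<in> val g' ` U" for y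
  proof -
    obtain z where z: "z \<in> U" "y = val g' z" using y by blast
    then have "k y = g' z" using k[of z] U(4,5) by auto
    then show ?thesis using z U(4) val_Some[of z g'] by auto
  qed
  moreover have "open (val g' ` U)"
    using local_homeoD(4)[OF S_local_homeo[OF g']] U by blast
  moreover have "k \<in> S" unfolding k_def by (intro S_comp S_inverse g g')
  moreover have "val g' ` U \<noteq> {}" "val g' ` U \<subseteq> dom k" using U(2) k_id by auto
  moreover have "quasi_effectiveness_condition S"
    using admissible by (simp add: admissible_generators_def)
  ultimately have "\<forall>y\<in>dom k. k y = Some y"
    unfolding quasi_effectiveness_condition_def by blast
  moreover have "val g' z \<in> dom k" using k[OF z(2)] z(1) by auto
  ultimately show ?thesis using k[OF z(2)] val_Some[OF z(2)] by simp
qed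

lemma S_equicontinuous: "compact K \<Longrightarrow> \<exists>l>0. equicontinuous_at_scale S K l"
  using strong_equicontinuity_at_scale[OF locally_compact] admissible
  by (auto simp: admissible_generators_def)

text \<open>The map \<open>e'\<close> need not lie in \<open>S\<close>, but its germs do. Open sets
  on which it restricts to \<open>S\<close>, with image points less than \<open>l\<close> apart,
  cover the compact set \<open>closure (dom e)\<close>; a Lebesgue number of this cover is
  \<open>\<mu>\<close>.\<close>

lemma uniform_extension_of_generator:
  assumes K: "compact K" "dom e \<subseteq> K" and e': "e' \<in> H" "closure (dom e) \<subseteq> dom e'" and "l > 0"
  shows "\<exists>\<mu>>0. \<forall>z\<in>dom e. ball z \<mu> \<subseteq> dom e' \<and> e' |` ball z \<mu> \<in> S \<and>
    (\<forall>y\<in>ball z \<mu>. dist (val e' z) (val e' y) < l)"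
proof -
  define \<G> where "\<G> = {G. open G \<and> G \<subseteq> dom e' \<and> e' |` G \<in> S \<and> (\<forall>y\<in>G. \<forall>z\<in>G. dist (val e' z) (val e' y) < l)}"
  have "closure (dom e) \<subseteq> K" using K by (simp add: closure_minimal compact_imp_closed)
  then have c: "compact (closure (dom e))"
    using compact_Int_closed[OF K(1) closed_closure, of "dom e"] by (simp add: Int_absorb1)
  have cover: "closure (dom e) \<subseteq> \<Union>\<G>"
  proof
    fix z assume "z \<in> closure (dom e)"
    then have z: "z \<in> dom e'" using e' by auto
    obtain V where V: "open V" "z \<in> V" "V \<subseteq> dom e'" "e' |` V \<in> S" using H_germ[OF e'(1) z] .
    let ?W = "{y \<in> dom e'. val e' y \<in> ball (val e' z) (l/2)}"
    have "open ?W" using local_homeo_open_vimage[OF H_local_homeo[OF e'(1)]] by blast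
    then have "open (V \<inter> ?W)" using V by auto
    moreover have "e' |` (V \<inter> ?W) \<in> S"
      using S_restrict[OF V(4) \<open>open ?W\<close>] by (simp add: restrict_restrict)
    moreover have "dist (val e' a) (val e' b) < l" if "a \<in> V \<inter> ?W" "b \<in> V \<inter> ?W" for a b
      using that dist_triangle_half_r[of "val e' z" "val e' a" l "val e' b"] by auto
    ultimately have "V \<inter> ?W \<in> \<G>" unfolding \<G>_def by auto
    moreover have "z \<in> V \<inter> ?W" using V z \<open>l > 0\<close> by auto
    ultimately show "z \<in> \<Union>\<G>" by blast
  qed
  have op: "open G" if "G \<in> \<G>" for G using that by (simp add: \<G>_def)
  have "\<exists>\<mu>>0. \<forall>z\<in>closure (dom e). \<exists>G\<in>\<G>. ball z \<mu> \<subseteq> G"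
    by (rule Heine_Borel_lemma[OF c cover op]) metis+
  then obtain \<mu> where \<mu>: "\<mu> > 0" "\<forall>z\<in>closure (dom e). \<exists>G\<in>\<G>. ball z \<mu> \<subseteq> G"
    by (elim exE conjE)
  have "ball z \<mu> \<subseteq> dom e' \<and> e' |` ball z \<mu> \<in> S \<and> (\<forall>y\<in>ball z \<mu>. dist (val e' z) (val e' y) < l)"
    if z: "z \<in> dom e" for z
  proof -
    have "z \<in> closure (dom e)" by (rule subsetD[OF closure_subset z])
    from bspec[OF \<mu>(2) this] obtain G where G: "G \<subseteq> dom e'" "e' |` G \<in> S" "\<forall>y\<in>G. \<forall>z\<in>G. dist (val e' z) (val e' y) < l"
      "ball z \<mu> \<subseteq> G"
      unfolding \<G>_def by (elim bexE CollectE conjE)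
    moreover have "e' |` G |` ball z \<mu> = e' |` ball z \<mu>"
      using G(4) by (simp add: restrict_restrict Int_absorb1)
    moreover have "z \<in> G" using G(4) \<mu>(1) by auto
    ultimately show ?thesis using S_restrict[OF G(2), of "ball z \<mu>"] by auto
  qed
  then show ?thesis using \<mu>(1) by blast
qed

text \<open>
  A composition of generators is extended factor by factor. The extension of the next factor is
  defined at the scale \<open>\<epsilon>1\<close>, and brings the image within the scale \<open>l\<close>, where equicontinuity of
  the whole composition applies and brings it back to the scale \<open>\<epsilon>1\<close>, regardless of the number of
  factors.
\<close>
lemma word_extension:
  assumes E: "\<And>e. e \<in> E \<Longrightarrow> dom e \<subseteq> K \<and> ran e \<subseteq> K \<and> local_homeo e \<and> e = ext e |` dom e"
    and \<mu>: "\<And>e z. e \<in> E \<Longrightarrow> z \<in> dom e \<Longrightarrow> ball z \<mu> \<subseteq> dom (ext e) \<and> ext e |` ball z \<mu> \<in> S \<and>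
      (\<forall>y\<in>ball z \<mu>. dist (val (ext e) z) (val (ext e) y) < l)"
    and pos: "0 < \<epsilon>1" "\<epsilon>1 \<le> \<mu>" "\<rho> \<le> \<mu>" "\<rho> \<le> l" "0 < \<rho>" "0 < l"
    and \<rho>: "\<And>h p q y y'. \<lbrakk>h \<in> S; p \<in> K; q \<in> K; y \<in> dom h \<inter> ball p l; y' \<in> dom h \<inter> ball p l;
      val h y \<in> ball q l; val h y' \<in> ball q l; dist y y' < \<rho>\<rbrakk> \<Longrightarrow> dist (val h y) (val h y') < \<epsilon>1"
    and w: "w \<in> words E" and x: "x \<in> dom w"
  shows "\<exists>f\<in>S. ball x \<rho> \<subseteq> dom f \<and> (\<forall>y\<in>ball x \<rho>. dist (val w x) (val f y) < \<epsilon>1) \<and> agree_near x w f"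
proof -
  \<comment> \<open>The self-improving estimate: once the image is known to stay within
    \<open>l\<close> of \<open>q\<close>, equicontinuity of the whole map \<open>f\<close> brings it
    within \<open>\<epsilon>1\<close>.\<close>
  have step: "\<forall>y\<in>ball x \<rho>. dist q (val f y) < \<epsilon>1"
    if "f \<in> S" "ball x \<rho> \<subseteq> dom f" "x \<in> K" "q \<in> K" "val f x = q" "\<forall>y\<in>ball x \<rho>. dist q (val f y) < l"
    for x q f
  proof
    fix y assume y: "y \<in> ball x \<rho>"
    have "dist (val f x) (val f y) < \<epsilon>1"
      using that(3-6) pos y subsetD[OF that(2), of x] subsetD[OF that(2) y]
      by (intro \<rho>[OF that(1,3,4)]) simp_all
    then show "dist q (val f y) < \<epsilon>1" using that by simp
  qed
  have sub: "dom w \<subseteq> K" if "w \<in> words E" for w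
    using that E by (induction) (auto simp: dom_map_comp)
  have val_ext: "val (ext e) z = val e z" if "e \<in> E" "z \<in> dom e" for e z
    using E[OF that(1)] that(2) by (metis val_restrict)
  have agree: "agree_near z e (ext e |` ball z \<mu>)" if "e \<in> E" "z \<in> dom e" for e z
  proof -
    have "open (dom e)" using E that local_homeoD by blast
    moreover have "e y = (ext e |` ball z \<mu>) y" if "y \<in> ball z \<mu> \<inter> dom e" for y
      using E[OF \<open>e \<in> E\<close>] that by (metis IntD1 IntD2 restrict_in)
    ultimately show ?thesis unfolding agree_near_def using \<mu>[OF that] that pos
      by (intro exI[of _ "ball z \<mu> \<inter> dom e"]) auto
  qed
  show ?thesis
    using w x
  proof (induction arbitrary: x)
    case (single e)
    let ?f = "ext e |` ball x \<mu>"
    have e: "ball x \<mu> \<subseteq> dom (ext e)" "?f \<in> S" "\<forall>y\<in>ball x \<mu>. dist (val e x) (val (ext e) y) < l"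
      using \<mu>[OF single] val_ext[OF single] by auto
    have b: "ball x \<rho> \<subseteq> ball x \<mu>" using pos by auto
    have "val e x \<in> K" using E[OF single.hyps] single.prems by (auto simp: ran_eq_val_image)
    then have "\<forall>y\<in>ball x \<rho>. dist (val e x) (val ?f y) < \<epsilon>1"
      using e b pos E[OF single.hyps] single val_ext[OF single]
      by (intro step) (auto simp: subset_iff)
    then show ?case using e b agree[OF single] by (intro bexI[of _ ?f]) auto
  next
    case (cons e w)
    have xw: "x \<in> dom w" and z: "val w x \<in> dom e" using cons.prems by (auto simp: dom_map_comp)
    let ?z = "val w x"
    obtain f where f: "f \<in> S" "ball x \<rho> \<subseteq> dom f" "\<forall>y\<in>ball x \<rho>. dist ?z (val f y) < \<epsilon>1" "agree_near x w f"
      using cons.IH[OF xw] by blast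
    let ?e = "ext e |` ball ?z \<mu>"
    have e: "ball ?z \<mu> \<subseteq> dom (ext e)" "?e \<in> S" "\<forall>y\<in>ball ?z \<mu>. dist (val e ?z) (val (ext e) y) < l"
      using \<mu>[OF cons.hyps(1) z] val_ext[OF cons.hyps(1) z] by auto
    have fy: "val f y \<in> ball ?z \<mu>" if "y \<in> ball x \<rho>" for y using f(3) that pos by force
    have d: "ball x \<rho> \<subseteq> dom (?e \<circ>\<^sub>m f)"
      using f(2) fy e(1) by (auto simp: dom_map_comp subset_iff)
    have v: "val (?e \<circ>\<^sub>m f) y = val (ext e) (val f y)" if "y \<in> ball x \<rho>" for y
      using f(2) that fy[OF that] by (simp add: val_map_comp subset_iff)
    have fx: "val f x = ?z" using agree_nearD[OF f(4)] by simp
    have "\<forall>y\<in>ball x \<rho>. dist (val e ?z) (val (?e \<circ>\<^sub>m f) y) < \<epsilon>1"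
    proof (rule step)
      show "?e \<circ>\<^sub>m f \<in> S" by (rule S_comp[OF e(2) f(1)])
      show "x \<in> K" using sub[OF cons.hyps(2)] xw by auto
      show "val e ?z \<in> K" using E[OF cons.hyps(1)] z by (auto simp: ran_eq_val_image)
      show "val (?e \<circ>\<^sub>m f) x = val e ?z" using v fx val_ext[OF cons.hyps(1) z] pos by simp
      show "\<forall>y\<in>ball x \<rho>. dist (val e ?z) (val (?e \<circ>\<^sub>m f) y) < l" using v fy e(3) by simp
    qed (rule d)
    moreover have "agree_near x (e \<circ>\<^sub>m w) (?e \<circ>\<^sub>m f)"
      using words_local_homeo[OF _ cons.hyps(2)] E agree[OF cons.hyps(1) z] f(4)
      by (intro agree_near_comp) auto
    moreover have "val (e \<circ>\<^sub>m w) x = val e ?z" using xw by (simp add: val_map_comp)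
    ultimately show ?case using d S_comp[OF e(2) f(1)] by (intro bexI[of _ "?e \<circ>\<^sub>m f"]) auto
  qed
qed

lemma uniform_extension_in_transversal:
  obtains U where "open U" "\<And>x. orbit H x \<inter> U \<noteq> {}"
    "\<And>\<epsilon>. \<epsilon> > 0 \<Longrightarrow> \<exists>\<rho>>0. \<forall>g\<in>S. \<forall>x\<in>dom g \<inter> U. val g x \<in> U \<longrightarrow>
      (\<exists>f\<in>S. ball x \<rho> \<subseteq> dom f \<and> (\<forall>y\<in>ball x \<rho>. dist (val g x) (val f y) < \<epsilon>) \<and> agree_near x g f)"
proof -
  obtain U E where U: "open U" "compact (closure U)" "\<forall>x. orbit H x \<inter> U \<noteq> {}"
    and E: "finite E" "symmetric_maps E" "generates E (pg_restriction H U)"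
      "\<forall>g\<in>E. \<exists>g'\<in>H. closure (dom g) \<subseteq> dom g' \<and> g = g' |` dom g"
    using compactly_generated unfolding compactly_generated_def by blast
  have "\<exists>\<rho>>0. \<forall>g\<in>S. \<forall>x\<in>dom g \<inter> U. val g x \<in> U \<longrightarrow>
      (\<exists>f\<in>S. ball x \<rho> \<subseteq> dom f \<and> (\<forall>y\<in>ball x \<rho>. dist (val g x) (val f y) < \<epsilon>) \<and> agree_near x g f)"
    if \<epsilon>: "\<epsilon> > 0" for \<epsilon>
  proof -
    define K where "K = closure U"
    have UK: "U \<subseteq> K" by (simp add: K_def closure_subset)
    have EH: "e \<in> H \<and> dom e \<subseteq> U \<and> ran e \<subseteq> U" if "e \<in> E" for e
      using E(3) that by (auto simp: generates_def pg_restriction_def)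
    obtain ext where ext: "\<And>e. e \<in> E \<Longrightarrow> ext e \<in> H \<and> closure (dom e) \<subseteq> dom (ext e) \<and> e = ext e |` dom e"
      using E(4) by metis
    obtain l where l: "l > 0" "equicontinuous_at_scale S K l"
      using S_equicontinuous U(2) K_def by blast
    have "\<exists>\<mu>>0. \<forall>e\<in>E. \<forall>z\<in>dom e. ball z \<mu> \<subseteq> dom (ext e) \<and> ext e |` ball z \<mu> \<in> S \<and>
      (\<forall>y\<in>ball z \<mu>. dist (val (ext e) z) (val (ext e) y) < l)"
    proof (rule finite_uniform_radius[OF E(1)])
      fix e assume "e \<in> E"
      then show "\<exists>\<mu>>0. \<forall>z\<in>dom e. ball z \<mu> \<subseteq> dom (ext e) \<and> ext e |` ball z \<mu> \<in> S \<and>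
        (\<forall>y\<in>ball z \<mu>. dist (val (ext e) z) (val (ext e) y) < l)"
        using ext[of e] EH[of e] UK U(2) K_def l(1)
        by (intro uniform_extension_of_generator[of K]) (simp_all, blast)
    next
      fix e and d d' :: real
      assume d: "\<forall>z\<in>dom e. ball z d \<subseteq> dom (ext e) \<and> ext e |` ball z d \<in> S \<and>
        (\<forall>y\<in>ball z d. dist (val (ext e) z) (val (ext e) y) < l)" "0 < d'" "d' \<le> d"
      show "\<forall>z\<in>dom e. ball z d' \<subseteq> dom (ext e) \<and> ext e |` ball z d' \<in> S \<and>
        (\<forall>y\<in>ball z d'. dist (val (ext e) z) (val (ext e) y) < l)"
      proof
        fix z assume z: "z \<in> dom e"
        have b: "ball z d' \<subseteq> ball z d" using d by auto
        then have "ext e |` ball z d |` ball z d' = ext e |` ball z d'"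
          by (simp add: restrict_restrict Int_absorb1)
        moreover have "ext e |` ball z d |` ball z d' \<in> S" using bspec[OF d(1) z] S_restrict by blast
        ultimately show "ball z d' \<subseteq> dom (ext e) \<and> ext e |` ball z d' \<in> S \<and>
          (\<forall>y\<in>ball z d'. dist (val (ext e) z) (val (ext e) y) < l)"
          using d(1) z b by (metis subset_iff)
      qed
    qed
    then obtain \<mu> where \<mu>: "\<mu> > 0" "\<And>e z. e \<in> E \<Longrightarrow> z \<in> dom e \<Longrightarrow> ball z \<mu> \<subseteq> dom (ext e) \<and>
      ext e |` ball z \<mu> \<in> S \<and> (\<forall>y\<in>ball z \<mu>. dist (val (ext e) z) (val (ext e) y) < l)"
      by blast
    \<comment> \<open>The bound by \<open>\<epsilon>\<close> is the required precision; the bound by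
      \<open>\<mu>\<close> keeps the image of the extended word where the next generator
      extends.\<close>
    define \<epsilon>1 where "\<epsilon>1 = min \<epsilon> \<mu>"
    have \<epsilon>1: "\<epsilon>1 > 0" "\<epsilon>1 \<le> \<mu>" "\<epsilon>1 \<le> \<epsilon>" using \<epsilon> \<mu>(1) by (auto simp: \<epsilon>1_def)
    obtain d where d: "d > 0" "\<And>h p q y y'. \<lbrakk>h \<in> S; p \<in> K; q \<in> K; y \<in> dom h \<inter> ball p l; y' \<in> dom h \<inter> ball p l;
      val h y \<in> ball q l; val h y' \<in> ball q l; dist y y' < d\<rbrakk> \<Longrightarrow> dist (val h y) (val h y') < \<epsilon>1"
      using l(2) \<epsilon>1(1) unfolding equicontinuous_at_scale_def by meson
    \<comment> \<open>The bound \<open>d\<close> serves the equicontinuity estimate,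
      \<open>l\<close> keeps the ball at the scale of that estimate, and \<open>\<mu>\<close> serves
      the innermost factor.\<close>
    define \<rho> where "\<rho> = min d (min \<mu> l)"
    have \<rho>: "0 < \<rho>" "\<rho> \<le> \<mu>" "\<rho> \<le> l" "\<rho> \<le> d" using d(1) \<mu>(1) l(1) by (auto simp: \<rho>_def)
    show ?thesis
    proof (intro exI[of _ \<rho>] conjI \<rho>(1) ballI impI)
      fix g x assume g: "g \<in> S" and x: "x \<in> dom g \<inter> U" and gx: "val g x \<in> U"
      \<comment> \<open>Keeping only points of \<open>U\<close> with image in \<open>U\<close> moves
        \<open>g\<close> into the restricted pseudogroup, where its germs are words in the finite
        set \<open>E\<close>.\<close>
      let ?V = "U \<inter> {y \<in> dom g. val g y \<in> U}"
      have V: "open ?V" using U(1) local_homeo_open_vimage[OF S_local_homeo[OF g]] by blast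
      have "g |` ?V \<in> H" using S_restrict[OF g V] S_subset_H by blast
      moreover have "ran (g |` ?V) \<subseteq> U"
        by (auto simp: ran_def restrict_map_def split: if_splits)
      ultimately have "g |` ?V \<in> pg_restriction H U" by (auto simp: pg_restriction_def)
      then have "g |` ?V \<in> generated E" using E(3) by (auto simp: generates_def)
      moreover have xV: "x \<in> ?V" using x gx by auto
      ultimately obtain w where w: "w \<in> words E" "agree_near x (g |` ?V) w"
        using generated_germ_word[OF _ E(2), of "g |` ?V" x] EH H_local_homeo by auto
      have gw: "agree_near x g w"
        using agree_near_trans[OF agree_near_restrict[OF V xV] w(2)] S_dom_open[OF g] x by blast
      have xw: "x \<in> dom w" "val w x = val g x" using agree_nearD[OF gw] by auto
      have "\<exists>f\<in>S. ball x \<rho> \<subseteq> dom f \<and> (\<forall>y\<in>ball x \<rho>. dist (val w x) (val f y) < \<epsilon>1) \<and> agree_near x w f"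
      proof (rule word_extension[OF _ \<mu>(2) \<epsilon>1(1,2) \<rho>(2,3,1) l(1) _ w(1) xw(1)])
        show "dom e \<subseteq> K \<and> ran e \<subseteq> K \<and> local_homeo e \<and> e = ext e |` dom e" if "e \<in> E" for e
          using EH[OF that] UK ext[OF that] H_local_homeo by blast
        show "dist (val h y) (val h y') < \<epsilon>1" if "h \<in> S" "p \<in> K" "q \<in> K" "y \<in> dom h \<inter> ball p l"
          "y' \<in> dom h \<inter> ball p l" "val h y \<in> ball q l" "val h y' \<in> ball q l" "dist y y' < \<rho>" for h p q y y'
          using that \<rho>(4) by (intro d(2)[of h p q]) auto
      qed
      then obtain f where f: "f \<in> S" "ball x \<rho> \<subseteq> dom f"
        "\<forall>y\<in>ball x \<rho>. dist (val w x) (val f y) < \<epsilon>1" "agree_near x w f"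
        by blast
      have "\<forall>y\<in>ball x \<rho>. dist (val g x) (val f y) < \<epsilon>"
        using f(3) xw(2) \<epsilon>1(3) by auto
      then show "\<exists>f\<in>S. ball x \<rho> \<subseteq> dom f \<and> (\<forall>y\<in>ball x \<rho>. dist (val g x) (val f y) < \<epsilon>) \<and> agree_near x g f"
        using f(1,2) agree_near_trans[OF gw f(4)] by (intro bexI[of _ f] conjI)
    qed
  qed
  then show thesis using that U by blast
qed

text \<open>Every orbit meets \<open>U\<close>, so maps \<open>a\<close> and \<open>b\<close> of
  \<open>S\<close> carry \<open>p\<close> and \<open>q\<close> into \<open>U\<close>, and
  conjugation by them transfers the extension from \<open>U\<close>. The resulting ball is centred
  at the fixed \<open>p\<close> rather than at the varying \<open>x\<close>, as a common domain for
  limits requires.\<close>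

lemma uniform_extension:
  assumes "\<epsilon> > 0"
  shows "\<exists>\<rho>>0. \<forall>g\<in>S. \<forall>x\<in>dom g. dist p x < \<rho> \<longrightarrow> dist q (val g x) < \<rho> \<longrightarrow>
    (\<exists>f\<in>S. ball p \<rho> \<subseteq> dom f \<and> (\<forall>y\<in>ball p \<rho>. dist q (val f y) < \<epsilon>) \<and> agree_near x g f)"
proof -
  obtain U where U: "open U" "\<And>x. orbit H x \<inter> U \<noteq> {}"
    and ext: "\<And>\<epsilon>. \<epsilon> > 0 \<Longrightarrow> \<exists>\<rho>>0. \<forall>g\<in>S. \<forall>x\<in>dom g \<inter> U. val g x \<in> U \<longrightarrow>
      (\<exists>f\<in>S. ball x \<rho> \<subseteq> dom f \<and> (\<forall>y\<in>ball x \<rho>. dist (val g x) (val f y) < \<epsilon>) \<and> agree_near x g f)"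
    using uniform_extension_in_transversal by metis
  have "\<exists>a\<in>S. p \<in> dom a \<and> val a p \<in> U" for p
  proof -
    obtain y h where h: "y \<in> U" "h \<in> H" "h p = Some y" using U(2)[of p] unfolding orbit_def by blast
    obtain V where V: "open V" "p \<in> V" "V \<subseteq> dom h" "h |` V \<in> S" using H_germ[OF h(2), of p] h(3) by blast
    then show ?thesis using h by (intro bexI[of _ "h |` V"]) auto
  qed
  then obtain a b where a: "a \<in> S" "p \<in> dom a" "val a p \<in> U" and b: "b \<in> S" "q \<in> dom b" "val b q \<in> U"
    by metis
  note lh = S_local_homeo
  let ?b' = "map_inverse b" and ?a' = "map_inverse a"
  have nbhd: "\<exists>r>0. ball x r \<subseteq> dom h \<and> (\<forall>y\<in>ball x r. val h y \<in> V)"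
    if h: "h \<in> S" "x \<in> dom h" "open V" "val h x \<in> V" for h x V
  proof -
    have "open {y \<in> dom h. val h y \<in> V}" using local_homeo_open_vimage[OF lh] h by blast
    then obtain r where "r > 0" "ball x r \<subseteq> {y \<in> dom h. val h y \<in> V}"
      using h openE[of "{y \<in> dom h. val h y \<in> V}" x] by blast
    then show ?thesis by blast
  qed
  have b': "?b' \<in> S" "val b q \<in> dom ?b'" "val ?b' (val b q) = q"
    using S_inverse[OF b(1)] b val_map_inverse[OF lh] by (auto simp: ran_eq_val_image)
  then have "val ?b' (val b q) \<in> ball q \<epsilon>" using assms by simp
  \<comment> \<open>The inverse of \<open>b\<close> turns the tolerance \<open>\<epsilon>0\<close>
    around \<open>val b q\<close> into \<open>\<epsilon>\<close> around \<open>q\<close>.\<close>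
  from nbhd[OF b'(1,2) open_ball this] obtain \<epsilon>0 where
    \<epsilon>0: "\<epsilon>0 > 0" "ball (val b q) \<epsilon>0 \<subseteq> dom ?b'" "\<forall>y\<in>ball (val b q) \<epsilon>0. val ?b' y \<in> ball q \<epsilon>"
    by blast
  \<comment> \<open>Radii are halved because the centre moves: \<open>val a x\<close> and
    \<open>val b (val g x)\<close> only lie near \<open>val a p\<close> and \<open>val b q\<close>,
    and the distance to the moving centre is a second half.\<close>
  obtain \<rho>0 where \<rho>0: "\<rho>0 > 0" "\<forall>g\<in>S. \<forall>x\<in>dom g \<inter> U. val g x \<in> U \<longrightarrow>
      (\<exists>f\<in>S. ball x \<rho>0 \<subseteq> dom f \<and> (\<forall>y\<in>ball x \<rho>0. dist (val g x) (val f y) < \<epsilon>0/2) \<and> agree_near x g f)"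
    using ext[of "\<epsilon>0/2"] \<epsilon>0(1) by auto
  obtain r1 where r1: "r1 > 0" "ball p r1 \<subseteq> dom a" "\<forall>y\<in>ball p r1. val a y \<in> U \<inter> ball (val a p) (\<rho>0/2)"
    using nbhd[OF a(1,2), of "U \<inter> ball (val a p) (\<rho>0/2)"] U(1) a(3) \<rho>0(1) by auto
  obtain r2 where r2: "r2 > 0" "ball q r2 \<subseteq> dom b" "\<forall>y\<in>ball q r2. val b y \<in> U \<inter> ball (val b q) (\<epsilon>0/2)"
    using nbhd[OF b(1,2), of "U \<inter> ball (val b q) (\<epsilon>0/2)"] U(1) b(3) \<epsilon>0(1) by auto
  define \<rho> where "\<rho> = min r1 r2"
  have \<rho>: "\<rho> > 0" "\<rho> \<le> r1" "\<rho> \<le> r2" using r1 r2 by (auto simp: \<rho>_def)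
  show ?thesis
  proof (intro exI[of _ \<rho>] conjI \<rho>(1) ballI impI)
    fix g x assume g: "g \<in> S" "x \<in> dom g" and px: "dist p x < \<rho>" and qx: "dist q (val g x) < \<rho>"
    have x: "x \<in> dom a" "val a x \<in> U" "dist (val a p) (val a x) < \<rho>0/2"
    proof -
      have "x \<in> ball p r1" using px \<rho> by simp
      then show "x \<in> dom a" "val a x \<in> U" "dist (val a p) (val a x) < \<rho>0/2" using r1(2,3) by (blast, simp_all)
    qed
    have gx: "val g x \<in> dom b" "val b (val g x) \<in> U" "dist (val b q) (val b (val g x)) < \<epsilon>0/2"
    proof -
      have "val g x \<in> ball q r2" using qx \<rho> by simp
      then show "val g x \<in> dom b" "val b (val g x) \<in> U" "dist (val b q) (val b (val g x)) < \<epsilon>0/2"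
        using r2(2,3) by (blast, simp_all)
    qed
    let ?G = "b \<circ>\<^sub>m g \<circ>\<^sub>m ?a'"
    have a'x: "val ?a' (val a x) = x" "val a x \<in> dom ?a'"
      using val_map_inverse[OF lh[OF a(1)] x(1)] x(1) by (auto simp: ran_eq_val_image)
    have G: "?G \<in> S" by (intro S_comp S_inverse a b g)
    have Gx: "val a x \<in> dom ?G" "val ?G (val a x) = val b (val g x)"
      using a'x g(2) gx(1) by (auto simp: dom_map_comp val_map_comp)
    obtain f where f: "f \<in> S" "ball (val a x) \<rho>0 \<subseteq> dom f"
      "\<forall>y\<in>ball (val a x) \<rho>0. dist (val b (val g x)) (val f y) < \<epsilon>0/2" "agree_near (val a x) ?G f"
      using \<rho>0(2) G Gx x gx by (metis IntI)
    let ?f = "?b' \<circ>\<^sub>m f \<circ>\<^sub>m a"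
    have ay: "y \<in> dom a" "val a y \<in> ball (val a x) \<rho>0" if "y \<in> ball p \<rho>" for y
    proof -
      have y: "y \<in> ball p r1" using that \<rho> by auto
      then show "y \<in> dom a" using r1(2) by blast
      have "dist (val a p) (val a y) < \<rho>0/2" using r1(3) y by auto
      then show "val a y \<in> ball (val a x) \<rho>0"
        using dist_triangle_half_r[of "val a p" "val a x" \<rho>0 "val a y"] x(3) by auto
    qed
    have fy: "val f (val a y) \<in> ball (val b q) \<epsilon>0" if "y \<in> ball p \<rho>" for y
      using dist_triangle_half_l[of "val b q" "val b (val g x)" \<epsilon>0 "val f (val a y)"] gx(3) f(3) ay[OF that]
      by (auto simp: dist_commute)
    have "?f \<in> S" by (intro S_comp S_inverse a b f)
    moreover have "y \<in> dom ?f \<and> dist q (val ?f y) < \<epsilon>" if "y \<in> ball p \<rho>" for y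
    proof -
      have "y \<in> dom (f \<circ>\<^sub>m a)" using ay[OF that] f(2) by (auto simp: dom_map_comp)
      moreover have "val (f \<circ>\<^sub>m a) y = val f (val a y)" using ay[OF that] by (simp add: val_map_comp)
      ultimately show ?thesis
        using fy[OF that] \<epsilon>0(2,3) by (auto simp: map_comp_assoc dom_map_comp val_map_comp)
    qed
    moreover have "agree_near x g ?f"
    proof -
      have *: "agree_near x (?b' \<circ>\<^sub>m (?G \<circ>\<^sub>m a)) (?b' \<circ>\<^sub>m (f \<circ>\<^sub>m a))"
      proof (intro agree_near_comp agree_near_refl)
        show "local_homeo (?G \<circ>\<^sub>m a)" "local_homeo a" by (intro lh S_comp G a)+
        show "agree_near (val a x) ?G f" by (rule f(4))
        show "open (dom a)" "x \<in> dom a" "open (dom ?b')" using x S_dom_open a b' by blast+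
        show "val (?G \<circ>\<^sub>m a) x \<in> dom ?b'"
          using x(1) Gx gx(1) by (auto simp: val_map_comp ran_eq_val_image)
      qed
      \<comment> \<open>Undoing the conjugation: wherever this composition is defined,
        \<open>a\<close> and \<open>b\<close> cancel against their inverses and \<open>g\<close> is
        left.\<close>
      have "agree_near x g (?b' \<circ>\<^sub>m (?G \<circ>\<^sub>m a))"
      proof -
        let ?W = "dom (?b' \<circ>\<^sub>m (?G \<circ>\<^sub>m a))"
        have "x \<in> ?W" using agree_nearD[OF *] by blast
        moreover have "open ?W" by (intro S_dom_open S_comp b' G a)
        moreover have "g y = (?b' \<circ>\<^sub>m (?G \<circ>\<^sub>m a)) y" if "y \<in> ?W" for y
        proof -
          obtain z where z: "(?b' \<circ>\<^sub>m (?G \<circ>\<^sub>m a)) y = Some z" using \<open>y \<in> ?W\<close> by blast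
          then obtain v where v: "a y = Some v" by (auto simp: map_comp_Some_iff)
          then have "?a' v = Some y" by (simp add: local_homeo_inverse_Some_iff lh a(1))
          then obtain w u where w: "g y = Some w" "b w = Some u" "?b' u = Some z"
            using z v by (auto simp: map_comp_Some_iff)
          then have "b z = Some u" by (simp add: local_homeo_inverse_Some_iff lh b(1))
          then have "z = w"
            using w(2) inj_onD[OF local_homeoD(3)[OF lh[OF b(1)]], of z w] by auto
          then show ?thesis using z w by simp
        qed
        ultimately show ?thesis unfolding agree_near_def
          by (intro exI[of _ ?W]) (auto simp: domIff)
      qed
      then show ?thesis using agree_near_trans * by (simp add: map_comp_assoc)
    qed
    ultimately show "\<exists>f\<in>S. ball p \<rho> \<subseteq> dom f \<and> (\<forall>y\<in>ball p \<rho>. dist q (val f y) < \<epsilon>) \<and> agree_near x g f"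
      by (intro bexI[of _ ?f] conjI subsetI ballI) blast+
  qed
qed

end

section \<open>Uniform approximation and the compact-open topology\<close>

text \<open>Uniform approximation on \<open>A\<close>. That \<open>A\<close> lies in
  \<open>dom h\<close> is not included; it is stated separately where values of \<open>h\<close> on
  \<open>A\<close> must be defined.\<close>

definition approximable :: "('a \<rightharpoonup> 'b::metric_space) set \<Rightarrow> ('a \<rightharpoonup> 'b) \<Rightarrow> 'a set \<Rightarrow> bool" where
  "approximable S h A \<longleftrightarrow> (\<forall>\<epsilon>>0. \<exists>f\<in>S. A \<subseteq> dom f \<and> (\<forall>y\<in>A. dist (val f y) (val h y) < \<epsilon>))"

lemma approximableE:
  assumes "approximable S h A" "\<epsilon> > 0"
  obtains f where "f \<in> S" "A \<subseteq> dom f" "\<forall>y\<in>A. dist (val f y) (val h y) < \<epsilon>"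
proof -
  have "\<exists>f\<in>S. A \<subseteq> dom f \<and> (\<forall>y\<in>A. dist (val f y) (val h y) < \<epsilon>)"
    using assms unfolding approximable_def by simp
  then show ?thesis using that by (elim bexE conjE)
qed

lemma approximable_mono:
  assumes "approximable S h A" "B \<subseteq> A" "S \<subseteq> T" "\<And>y. y \<in> B \<Longrightarrow> val h y = val k y"
  shows "approximable T k B"
  unfolding approximable_def
proof (intro allI impI)
  fix \<epsilon> :: real assume "\<epsilon> > 0"
  from approximableE[OF assms(1) this] obtain f where f: "f \<in> S" "A \<subseteq> dom f"
    "\<forall>y\<in>A. dist (val f y) (val h y) < \<epsilon>" .
  have "\<forall>y\<in>B. dist (val f y) (val k y) < \<epsilon>" using f(3) assms(2,4) by (metis subsetD)
  moreover have "f \<in> T" using f(1) assms(3) by (rule subsetD[rotated])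
  moreover have "B \<subseteq> dom f" using f(2) assms(2) by (rule order_trans[rotated])
  ultimately show "\<exists>f\<in>T. B \<subseteq> dom f \<and> (\<forall>y\<in>B. dist (val f y) (val k y) < \<epsilon>)"
    by (intro bexI[of _ f] conjI)
qed

lemma approximable_continuous_on:
  fixes h :: "'a::metric_space \<rightharpoonup> 'b::metric_space"
  assumes S: "\<And>f. f \<in> S \<Longrightarrow> continuous_on (dom f) (val f)" and h: "approximable S h A"
  shows "continuous_on A (val h)"
  unfolding continuous_on_iff
proof (intro ballI allI impI)
  fix x and \<epsilon> :: real assume x: "x \<in> A" and "\<epsilon> > 0"
  then have \<epsilon>: "\<epsilon>/3 > 0" by simp
  obtain f where f: "f \<in> S" "A \<subseteq> dom f" "\<forall>y\<in>A. dist (val f y) (val h y) < \<epsilon>/3"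
    using approximableE[OF h \<epsilon>] .
  have "continuous_on A (val f)" using S[OF f(1)] f(2) by (rule continuous_on_subset)
  then obtain d where d: "d > 0" "\<forall>y\<in>A. dist y x < d \<longrightarrow> dist (val f y) (val f x) < \<epsilon>/3"
    using x \<epsilon> unfolding continuous_on_iff by blast
  have "dist (val h y) (val h x) < \<epsilon>" if "y \<in> A" "dist y x < d" for y
  proof -
    have "dist (val h y) (val h x) \<le> dist (val f y) (val h y) + dist (val f y) (val f x) + dist (val f x) (val h x)"
      by metric
    then show ?thesis using bspec[OF f(3) that(1)] bspec[OF f(3) x] d(2) that by fastforce
  qed
  then show "\<exists>d>0. \<forall>y\<in>A. dist y x < d \<longrightarrow> dist (val h y) (val h x) < \<epsilon>" using d(1) by metis
qed

text \<open>Uniform continuity of \<open>g\<close> on the compact \<open>C\<close> tolerates an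
  error in the inner map, and the margin \<open>r\<close> keeps the approximate inner values in
  \<open>C\<close>, where the outer approximation is available.\<close>

lemma approximable_comp:
  fixes g h :: "'a::metric_space \<rightharpoonup> 'a"
  assumes S: "closed_under_composition S"
    and C: "compact C" "continuous_on C (val g)" "approximable S g C"
    and h: "approximable S h A" "A \<subseteq> dom h" and r: "r > 0" "\<And>y. y \<in> A \<Longrightarrow> ball (val h y) r \<subseteq> C"
  shows "approximable S (g \<circ>\<^sub>m h) A"
  unfolding approximable_def
proof (intro allI impI)
  fix \<epsilon> :: real assume "\<epsilon> > 0"
  then have \<epsilon>: "\<epsilon>/2 > 0" by simp
  obtain d where d: "d > 0" "\<And>y z. y \<in> C \<Longrightarrow> z \<in> C \<Longrightarrow> dist z y < d \<Longrightarrow> dist (val g z) (val g y) < \<epsilon>/2"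
    using compact_uniformly_continuous[OF C(2,1)] \<epsilon> unfolding uniformly_continuous_on_def by metis
  obtain a where a: "a \<in> S" "C \<subseteq> dom a" "\<forall>y\<in>C. dist (val a y) (val g y) < \<epsilon>/2"
    using approximableE[OF C(3) \<epsilon>] .
  have "min d r > 0" using d r by simp
  from approximableE[OF h(1) this] obtain b where b: "b \<in> S" "A \<subseteq> dom b"
    "\<forall>y\<in>A. dist (val b y) (val h y) < min d r" .
  have *: "val b y \<in> C" "y \<in> dom (a \<circ>\<^sub>m b)" "dist (val (a \<circ>\<^sub>m b) y) (val (g \<circ>\<^sub>m h) y) < \<epsilon>" if y: "y \<in> A" for y
  proof -
    have "val b y \<in> ball (val h y) r" "val h y \<in> ball (val h y) r"
      using bspec[OF b(3) y] r(1) by (auto simp: dist_commute)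
    then have C': "val b y \<in> C" "val h y \<in> C" using r(2)[OF y] by blast+
    have dom: "y \<in> dom b" "y \<in> dom h" "val b y \<in> dom a" using y b(2) h(2) a(2) C' by blast+
    show "val b y \<in> C" by fact
    show "y \<in> dom (a \<circ>\<^sub>m b)" using dom by (simp add: dom_map_comp)
    have "dist (val a (val b y)) (val g (val b y)) < \<epsilon>/2" using a(3) C' by simp
    moreover have "dist (val g (val b y)) (val g (val h y)) < \<epsilon>/2" using d(2) C' bspec[OF b(3) y] by simp
    ultimately have "dist (val a (val b y)) (val g (val h y)) < \<epsilon>" by metric
    then show "dist (val (a \<circ>\<^sub>m b) y) (val (g \<circ>\<^sub>m h) y) < \<epsilon>" using dom by (simp add: val_map_comp)
  qed
  have "a \<circ>\<^sub>m b \<in> S" using S a(1) b(1) unfolding closed_under_composition_def by blast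
  then show "\<exists>f\<in>S. A \<subseteq> dom f \<and> (\<forall>y\<in>A. dist (val f y) (val (g \<circ>\<^sub>m h) y) < \<epsilon>)"
    using * by (intro bexI[of _ "a \<circ>\<^sub>m b"] conjI subsetI ballI)
qed

text \<open>Continuity of \<open>h\<close> and compactness cut \<open>K\<close> into finitely many
  compact pieces on which \<open>h\<close> varies by less than \<open>\<epsilon>/2\<close>. One
  subbasic condition per piece keeps a nearby map within \<open>\<epsilon>\<close> of
  \<open>h\<close> on all of \<open>K\<close>.\<close>

lemma compact_open_closure_approximable:
  fixes h :: "'a::metric_space \<rightharpoonup> 'b::metric_space"
  assumes h: "h \<in> compact_open_topology O' closure_of (cmaps O' \<inter> S)"
    and K: "compact K" "K \<subseteq> O'"
  shows "approximable S h K"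
  unfolding approximable_def
proof (intro allI impI)
  fix \<epsilon> :: real assume "\<epsilon> > 0"
  have hc: "h \<in> cmaps O'" using h by (simp add: in_closure_of topspace_compact_open_topology)
  then have "continuous_on K (val h)" using K(2) continuous_on_subset unfolding cmaps_def by blast
  then have "\<exists>r>0. \<forall>y\<in>K. dist y z \<le> r \<longrightarrow> dist (val h y) (val h z) < \<epsilon>/2" if "z \<in> K" for z
  proof -
    have "\<epsilon>/2 > 0" using \<open>\<epsilon> > 0\<close> by simp
    then obtain d where "d > 0" "\<forall>y\<in>K. dist y z < d \<longrightarrow> dist (val h y) (val h z) < \<epsilon>/2"
      using \<open>continuous_on K (val h)\<close> \<open>z \<in> K\<close> unfolding continuous_on_iff by blast
    then show ?thesis by (intro exI[of _ "d/2"]) simp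
  qed
  then obtain r where r: "\<And>z. z \<in> K \<Longrightarrow> r z > 0"
    "\<And>z y. z \<in> K \<Longrightarrow> y \<in> K \<Longrightarrow> dist y z \<le> r z \<Longrightarrow> dist (val h y) (val h z) < \<epsilon>/2"
    by metis
  have cover: "K \<subseteq> (\<Union>z\<in>K. ball z (r z))" using r(1) by force
  obtain F where F: "F \<subseteq> K" "finite F" "K \<subseteq> (\<Union>z\<in>F. ball z (r z))"
    by (rule compactE_image[OF K(1) open_ball cover])
  define N where "N = (\<lambda>z. {f \<in> cmaps O'. val f ` (K \<inter> cball z (r z)) \<subseteq> ball (val h z) (\<epsilon>/2)})"
  have N: "openin (compact_open_topology O') (N z)" for z
  proof -
    have "compact (K \<inter> cball z (r z))" using K(1) by (rule compact_Int_closed) simp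
    moreover have "K \<inter> cball z (r z) \<subseteq> O'" using K(2) by blast
    ultimately show ?thesis unfolding N_def compact_open_topology_def
      by (intro topology_generated_by_Basis) blast
  qed
  have "h \<in> N z" if "z \<in> F" for z
    using that F(1) r(2)[of z] hc unfolding N_def by (auto simp: dist_commute subset_iff)
  \<comment> \<open>The intersection with the whole space covers the case of empty \<open>F\<close>,
    where the indexed intersection is the universe of the type.\<close>
  moreover have "openin (compact_open_topology O') (topspace (compact_open_topology O') \<inter> (\<Inter>z\<in>F. N z))"
    using F(2) N by (induction F) (auto simp: Int_left_commute openin_Int)
  ultimately obtain f where f: "f \<in> cmaps O' \<inter> S" "\<And>z. z \<in> F \<Longrightarrow> f \<in> N z"
    using h unfolding in_closure_of by (metis (no_types, lifting) INT_I INT_D IntI IntD2)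
  have "dist (val f y) (val h y) < \<epsilon>" if y: "y \<in> K" for y
  proof -
    obtain z where z: "z \<in> F" "dist z y < r z" using F(3) y by auto
    have "y \<in> K \<inter> cball z (r z)" using y z(2) by simp
    then have "val f y \<in> ball (val h z) (\<epsilon>/2)" using f(2)[OF z(1)] unfolding N_def by blast
    moreover have "dist (val h y) (val h z) < \<epsilon>/2"
      using z F(1) y by (intro r(2)) (auto simp: dist_commute)
    ultimately show ?thesis unfolding mem_ball by metric
  qed
  moreover have "K \<subseteq> dom f" "f \<in> S" using f(1) K(2) by (auto simp: cmaps_def simp del: domIff)
  ultimately show "\<exists>f\<in>S. K \<subseteq> dom f \<and> (\<forall>y\<in>K. dist (val f y) (val h y) < \<epsilon>)"
    by (intro bexI[of _ f] conjI ballI)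
qed

text \<open>For a subbasic set, the compact image of \<open>K\<close> under \<open>h\<close> keeps a
  positive margin inside the open \<open>V\<close>; intersections take the smaller margin and unions
  inherit one.\<close>

lemma compact_open_neighbourhood_uniform:
  fixes h :: "'a::metric_space \<rightharpoonup> 'b::metric_space"
  assumes T: "openin (compact_open_topology O') T" and h: "h \<in> T" "h \<in> cmaps O'"
  shows "\<exists>\<epsilon>>0. \<forall>f\<in>cmaps O'. (\<forall>y\<in>O'. dist (val f y) (val h y) < \<epsilon>) \<longrightarrow> f \<in> T"
  using T h(1) unfolding compact_open_topology_def openin_topology_generated_by_iff
proof induction
  case Empty
  then show ?case by simp
next
  case (Int a b)
  obtain e where e: "e > 0" "\<forall>f\<in>cmaps O'. (\<forall>y\<in>O'. dist (val f y) (val h y) < e) \<longrightarrow> f \<in> a"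
    using Int by blast
  obtain e' where e': "e' > 0" "\<forall>f\<in>cmaps O'. (\<forall>y\<in>O'. dist (val f y) (val h y) < e') \<longrightarrow> f \<in> b"
    using Int by blast
  show ?case using e e' by (intro exI[of _ "min e e'"]) simp
next
  case (UN K)
  then show ?case by (meson UnionE UnionI)
next
  case (Basis s)
  then obtain K V where KV: "compact K" "K \<subseteq> O'" "open V" "s = {h \<in> cmaps O'. val h ` K \<subseteq> V}"
    by blast
  have "compact (val h ` K)"
    using h(2) KV continuous_on_subset unfolding cmaps_def by (blast intro: compact_continuous_image)
  moreover have "val h ` K \<subseteq> V" using Basis KV by simp
  ultimately obtain e where e: "e > 0" "(\<Union>x\<in>val h ` K. ball x e) \<subseteq> V"
    using compact_subset_open_imp_ball_epsilon_subset KV(3) by metis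
  have "f \<in> s" if f: "f \<in> cmaps O'" "\<forall>y\<in>O'. dist (val f y) (val h y) < e" for f
  proof -
    have "val f y \<in> V" if "y \<in> K" for y
    proof -
      have "val f y \<in> ball (val h y) e" using f(2) KV(2) that by (auto simp: dist_commute)
      then show ?thesis using e(2) that by blast
    qed
    then show ?thesis using f(1) KV(4) by blast
  qed
  then show ?case using e(1) by blast
qed

text \<open>An approximating map may be defined beyond \<open>O'\<close>; closure under restriction
  cuts it down to a member of both \<open>cmaps O'\<close> and \<open>S\<close>.\<close>

lemma approximable_compact_open_closure:
  fixes h :: "'a::metric_space \<rightharpoonup> 'a"
  assumes S: "\<And>f. f \<in> S \<Longrightarrow> continuous_on (dom f) (val f)" "closed_under_restriction S"
    and O': "open O'" "O' \<subseteq> dom h" and h: "approximable S h O'"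
  shows "h |` O' \<in> compact_open_topology O' closure_of (cmaps O' \<inter> S)"
  unfolding in_closure_of topspace_compact_open_topology
proof (intro conjI allI impI)
  have cm: "k |` O' \<in> cmaps O'" if "O' \<subseteq> dom k" "continuous_on O' (val k)" for k :: "'a \<rightharpoonup> 'a"
  proof -
    have "continuous_on O' (val (k |` O'))" by (rule continuous_on_eq[OF that(2)]) simp
    moreover have "dom (k |` O') = O'" using that(1) by auto
    ultimately show ?thesis by (simp add: cmaps_def)
  qed
  have hc: "continuous_on O' (val h)" using approximable_continuous_on[OF S(1) h] by blast
  show "h |` O' \<in> cmaps O'" by (rule cm[OF O'(2) hc])
  fix T assume T: "h |` O' \<in> T \<and> openin (compact_open_topology O') T"
  then obtain \<epsilon> where \<epsilon>: "\<epsilon> > 0" "\<forall>f\<in>cmaps O'. (\<forall>y\<in>O'. dist (val f y) (val (h |` O') y) < \<epsilon>) \<longrightarrow> f \<in> T"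
    using compact_open_neighbourhood_uniform[of O' T "h |` O'"] cm[OF O'(2) hc] by blast
  obtain f where f: "f \<in> S" "O' \<subseteq> dom f" "\<forall>y\<in>O'. dist (val f y) (val h y) < \<epsilon>"
    using approximableE[OF h \<epsilon>(1)] .
  have "f |` O' \<in> cmaps O'" using cm[OF f(2)] continuous_on_subset[OF S(1)[OF f(1)] f(2)] by blast
  moreover have "f |` O' \<in> T" using \<epsilon>(2) calculation f(3) by simp
  moreover have "f |` O' \<in> S" using S(2) f(1) O'(1) unfolding closed_under_restriction_def by blast
  ultimately show "\<exists>f. f \<in> cmaps O' \<inter> S \<and> f \<in> T" by blast
qed

lemma compact_open_nbhd:
  fixes A :: "'a::metric_space set"
  assumes lc: "locally compact (UNIV :: 'a set)" and A: "compact A" "open V" "A \<subseteq> V"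
  obtains C r where "r > 0" "compact C" "C \<subseteq> V" "\<And>x. x \<in> A \<Longrightarrow> ball x r \<subseteq> C"
proof -
  have "\<exists>r. r > 0 \<and> compact (cball x r) \<and> cball x r \<subseteq> V" if "x \<in> A" for x
    using locally_compact_cball[OF lc A(2), of x] that A(3) by (metis subsetD)
  then obtain r where r: "\<And>x. x \<in> A \<Longrightarrow> r x > 0" "\<And>x. x \<in> A \<Longrightarrow> compact (cball x (r x))"
    "\<And>x. x \<in> A \<Longrightarrow> cball x (r x) \<subseteq> V"
    by metis
  have cover: "A \<subseteq> (\<Union>x\<in>A. ball x (r x))" using r(1) by force
  obtain F where F: "F \<subseteq> A" "finite F" "A \<subseteq> (\<Union>x\<in>F. ball x (r x))"
    by (rule compactE_image[OF A(1) open_ball cover])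
  have "open (\<Union>x\<in>F. ball x (r x))" by blast
  then obtain e where e: "e > 0" "(\<Union>x\<in>A. ball x e) \<subseteq> (\<Union>x\<in>F. ball x (r x))"
    using compact_subset_open_imp_ball_epsilon_subset[OF A(1) _ F(3)] by metis
  let ?C = "\<Union>x\<in>F. cball x (r x)"
  have "compact ?C" using F r(2) by (intro compact_UN) auto
  moreover have "?C \<subseteq> V" using r(3) F(1) by blast
  moreover have "(\<Union>x\<in>F. ball x (r x)) \<subseteq> ?C" by (intro UN_mono) auto
  then have "ball x e \<subseteq> ?C" if "x \<in> A" for x using e(2) that by blast
  ultimately show thesis using that[of e ?C] e(1) by blast
qed

section \<open>Maps that are locally limits of generators\<close>

context admissible_pseudogroup
begin

lemma S_continuous_on: "f \<in> S \<Longrightarrow> continuous_on (dom f) (val f)"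
  by (simp add: S_local_homeo local_homeoD)

lemma S_closed_comp: "closed_under_composition S"
  and S_closed_restrict: "closed_under_restriction S"
  using admissible by (auto simp: admissible_generators_def)

lemma approximable_S_continuous_on: "approximable S h A \<Longrightarrow> continuous_on A (val h)"
  using approximable_continuous_on S_continuous_on by metis

text \<open>Inside \<open>O'\<close> take an open ball whose closed ball is compact and still
  inside: on it compact-open limits are uniform limits. Conversely, uniform closeness implies
  compact-open closeness. Afterwards only uniform approximation is used.\<close>

lemma pg_tilde_iff:
  "h \<in> pg_tilde S \<longleftrightarrow> (\<forall>x\<in>dom h. \<exists>O'. open O' \<and> x \<in> O' \<and> O' \<subseteq> dom h \<and> approximable S h O')"
proof
  assume h: "h \<in> pg_tilde S"
  show "\<forall>x\<in>dom h. \<exists>O'. open O' \<and> x \<in> O' \<and> O' \<subseteq> dom h \<and> approximable S h O'"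
  proof
    fix x assume "x \<in> dom h"
    then obtain O' where O': "open O'" "x \<in> O'" "O' \<subseteq> dom h"
      "h |` O' \<in> compact_open_topology O' closure_of (cmaps O' \<inter> S)"
      using h unfolding pg_tilde_def by blast
    obtain r where r: "r > 0" "compact (cball x r)" "cball x r \<subseteq> O'"
      using locally_compact_cball[OF locally_compact O'(1,2)] .
    have "approximable S (h |` O') (cball x r)"
      by (rule compact_open_closure_approximable[OF O'(4) r(2,3)])
    then have "approximable S h (ball x r)"
    proof (rule approximable_mono)
      show "val (h |` O') y = val h y" if "y \<in> ball x r" for y
        using that r(3) ball_subset_cball[of x r] by (intro val_restrict) blast
    qed auto
    then show "\<exists>O'. open O' \<and> x \<in> O' \<and> O' \<subseteq> dom h \<and> approximable S h O'"
      using r(1,3) O'(3) ball_subset_cball[of x r] by (intro exI[of _ "ball x r"]) force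
  qed
next
  assume h: "\<forall>x\<in>dom h. \<exists>O'. open O' \<and> x \<in> O' \<and> O' \<subseteq> dom h \<and> approximable S h O'"
  have "open (dom h)" using h by (subst open_subopen) blast
  moreover have "\<exists>O'. open O' \<and> x \<in> O' \<and> O' \<subseteq> dom h \<and>
      h |` O' \<in> compact_open_topology O' closure_of (cmaps O' \<inter> S)" if "x \<in> dom h" for x
    using bspec[OF h that] approximable_compact_open_closure[OF S_continuous_on S_closed_restrict]
    by blast
  ultimately show "h \<in> pg_tilde S" unfolding pg_tilde_def by blast
qed

lemma pg_tildeE:
  assumes "h \<in> pg_tilde S" "x \<in> dom h"
  obtains O' where "open O'" "x \<in> O'" "O' \<subseteq> dom h" "approximable S h O'" "continuous_on O' (val h)"
  using assms approximable_S_continuous_on unfolding pg_tilde_iff by metis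

lemma pg_tilde_comp:
  assumes g: "g \<in> pg_tilde S" and h: "h \<in> pg_tilde S"
  shows "g \<circ>\<^sub>m h \<in> pg_tilde S"
  unfolding pg_tilde_iff
proof
  fix x assume "x \<in> dom (g \<circ>\<^sub>m h)"
  then have x: "x \<in> dom h" "val h x \<in> dom g" by (auto simp: dom_map_comp)
  obtain O1 where O1: "open O1" "x \<in> O1" "O1 \<subseteq> dom h" "approximable S h O1" "continuous_on O1 (val h)"
    using pg_tildeE[OF h x(1)] .
  obtain O2 where O2: "open O2" "val h x \<in> O2" "O2 \<subseteq> dom g" "approximable S g O2" "continuous_on O2 (val g)"
    using pg_tildeE[OF g x(2)] .
  obtain r where r: "r > 0" "compact (cball (val h x) r)" "cball (val h x) r \<subseteq> O2"
    using locally_compact_cball[OF locally_compact O2(1,2)] .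
  let ?W = "val h -` ball (val h x) (r/2) \<inter> O1"
  have W: "open ?W" using continuous_on_open_vimage[OF O1(1)] O1(5) open_ball by blast
  have "approximable S (g \<circ>\<^sub>m h) ?W"
  proof (rule approximable_comp[OF S_closed_comp r(2)])
    show "continuous_on (cball (val h x) r) (val g)" by (rule continuous_on_subset[OF O2(5) r(3)])
    show "approximable S g (cball (val h x) r)" by (rule approximable_mono[OF O2(4) r(3) order_refl]) simp
    show "approximable S h ?W" by (rule approximable_mono[OF O1(4) _ order_refl]) auto
    show "?W \<subseteq> dom h" using O1(3) by blast
    show "r/2 > 0" using r(1) by simp
    show "ball (val h y) (r/2) \<subseteq> cball (val h x) r" if y: "y \<in> ?W" for y
    proof
      fix z assume "z \<in> ball (val h y) (r/2)"
      moreover have "dist (val h x) (val h y) < r/2" using y by simp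
      ultimately show "z \<in> cball (val h x) r" unfolding mem_ball mem_cball by metric
    qed
  qed
  moreover have "x \<in> ?W" using O1(2) r(1) by simp
  moreover have "?W \<subseteq> dom (g \<circ>\<^sub>m h)"
  proof
    fix w assume w: "w \<in> ?W"
    then have "val h w \<in> cball (val h x) r" using r(1) by simp
    then have "val h w \<in> dom g" using r(3) O2(3) by blast
    moreover have "w \<in> dom h" using w O1(3) by blast
    ultimately show "w \<in> dom (g \<circ>\<^sub>m h)" by (simp add: dom_map_comp)
  qed
  ultimately show "\<exists>O'. open O' \<and> x \<in> O' \<and> O' \<subseteq> dom (g \<circ>\<^sub>m h) \<and> approximable S (g \<circ>\<^sub>m h) O'"
    using W by blast
qed

lemma pg_tilde_combination:
  assumes F: "F \<subseteq> pg_tilde S" and h: "is_combination F h"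
  shows "h \<in> pg_tilde S"
  unfolding pg_tilde_iff
proof
  fix x assume "x \<in> dom h"
  then obtain f where f: "f \<in> F" "x \<in> dom f" using h unfolding is_combination_iff by blast
  then have "f \<in> pg_tilde S" using F by blast
  then obtain O' where O': "open O'" "x \<in> O'" "O' \<subseteq> dom f" "approximable S f O'"
    using pg_tildeE f(2) by metis
  have eq: "h y = f y" if "y \<in> O'" for y
    using h f(1) O'(3) that unfolding is_combination_iff by (metis domD subsetD)
  then have "approximable S h O'" using O'(4) by (intro approximable_mono[OF O'(4)]) auto
  moreover have "O' \<subseteq> dom h" using eq O'(3) unfolding dom_def by auto
  ultimately show "\<exists>O'. open O' \<and> x \<in> O' \<and> O' \<subseteq> dom h \<and> approximable S h O'" using O' by blast
qed

lemma pg_tilde_restrict: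
  assumes h: "h \<in> pg_tilde S" and U: "open U"
  shows "h |` U \<in> pg_tilde S"
  unfolding pg_tilde_iff
proof
  fix x assume "x \<in> dom (h |` U)"
  then have x: "x \<in> dom h" "x \<in> U" by auto
  obtain O' where O': "open O'" "x \<in> O'" "O' \<subseteq> dom h" "approximable S h O'"
    using pg_tildeE[OF h x(1)] .
  have "approximable S (h |` U) (O' \<inter> U)" by (rule approximable_mono[OF O'(4)]) auto
  moreover have "O' \<inter> U \<subseteq> dom (h |` U)" using O'(3) unfolding dom_restrict by blast
  ultimately show "\<exists>O'. open O' \<and> x \<in> O' \<and> O' \<subseteq> dom (h |` U) \<and> approximable S (h |` U) O'"
    using O' U x by (intro exI[of _ "O' \<inter> U"]) auto
qed

text \<open>The germ of the inverse of \<open>f\<close> at \<open>val f x\<close> extends to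
  \<open>g\<close> on a ball around \<open>val h x\<close> whose radius does not depend on
  \<open>f\<close>. Rigidity, applied to \<open>f\<close> and to its inverse, makes \<open>f\<close>
  and \<open>g\<close> mutually inverse wherever they meet. Only \<open>f\<close> and
  \<open>g\<close> depend on the precision \<open>\<eta>\<close>; \<open>b\<close> caps the
  radius.\<close>

lemma approximate_inverses:
  assumes O': "x \<in> O'" "approximable S h O'" and \<epsilon>: "\<epsilon> > 0" "ball x \<epsilon> \<subseteq> O'" and b: "b > 0"
  obtains \<rho> where "\<rho> > 0" "\<rho> \<le> b"
    "\<And>\<eta>. \<eta> > 0 \<Longrightarrow> \<exists>f\<in>S. \<exists>g\<in>S. O' \<subseteq> dom f \<and> (\<forall>w\<in>O'. dist (val f w) (val h w) < \<eta>) \<and>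
      ball (val h x) \<rho> \<subseteq> dom g \<and> (\<forall>z\<in>ball (val h x) \<rho>. val g z \<in> ball x \<epsilon> \<and> val f (val g z) = z) \<and>
      (\<forall>w\<in>O'. val f w \<in> ball (val h x) \<rho> \<longrightarrow> val g (val f w) = w)"
proof -
  obtain \<rho>' where \<rho>': "\<rho>' > 0" "\<forall>g\<in>S. \<forall>z\<in>dom g. dist (val h x) z < \<rho>' \<longrightarrow> dist x (val g z) < \<rho>' \<longrightarrow>
    (\<exists>f\<in>S. ball (val h x) \<rho>' \<subseteq> dom f \<and> (\<forall>y\<in>ball (val h x) \<rho>'. dist x (val f y) < \<epsilon>) \<and> agree_near z g f)"
    using uniform_extension[OF \<epsilon>(1), of "val h x" x] by blast
  define \<rho> where "\<rho> = min \<rho>' b"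
  have \<rho>: "\<rho> > 0" "\<rho> \<le> b" "\<rho> \<le> \<rho>'" using \<rho>'(1) b by (auto simp: \<rho>_def)
  have b\<rho>: "ball (val h x) \<rho> \<subseteq> ball (val h x) \<rho>'" using \<rho>(3) by auto
  have "\<exists>f\<in>S. \<exists>g\<in>S. O' \<subseteq> dom f \<and> (\<forall>w\<in>O'. dist (val f w) (val h w) < \<eta>) \<and>
      ball (val h x) \<rho> \<subseteq> dom g \<and> (\<forall>z\<in>ball (val h x) \<rho>. val g z \<in> ball x \<epsilon> \<and> val f (val g z) = z) \<and>
      (\<forall>w\<in>O'. val f w \<in> ball (val h x) \<rho> \<longrightarrow> val g (val f w) = w)" if "\<eta> > 0" for \<eta>
  proof -
    \<comment> \<open>Besides the requested precision, \<open>val f x\<close> must be within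
      \<open>\<rho>'\<close> of \<open>val h x\<close> for the extension to apply.\<close>
    have "min \<eta> \<rho>' > 0" using that \<rho>'(1) by simp
    from approximableE[OF O'(2) this] obtain f where f: "f \<in> S" "O' \<subseteq> dom f"
      "\<forall>y\<in>O'. dist (val f y) (val h y) < min \<eta> \<rho>'" .
    have lf: "local_homeo f" by (rule S_local_homeo[OF f(1)])
    have xf: "x \<in> dom f" using f(2) O'(1) by blast
    let ?f' = "map_inverse f"
    have f': "?f' \<in> S" "val f x \<in> dom ?f'" "val ?f' (val f x) = x" "dist (val h x) (val f x) < \<rho>'"
      using S_inverse[OF f(1)] xf val_map_inverse[OF lf xf] bspec[OF f(3) O'(1)]
      by (simp_all add: ran_eq_val_image dist_commute)
    moreover have "dist x (val ?f' (val f x)) < \<rho>'" using f'(3) \<rho>'(1) by simp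
    ultimately obtain g where g: "g \<in> S" "ball (val h x) \<rho>' \<subseteq> dom g"
      "\<forall>y\<in>ball (val h x) \<rho>'. dist x (val g y) < \<epsilon>" "agree_near (val f x) ?f' g"
      using \<rho>'(2) by blast
    have lg: "local_homeo g" by (rule S_local_homeo[OF g(1)])
    have ag: "agree_near x f (map_inverse g)"
      using agree_near_inverse[OF local_homeo_inverse[OF lf] lg g(4)] f'(3)
      by (simp add: map_inverse_map_inverse lf)
    have 1: "val g z \<in> ball x \<epsilon> \<and> val f (val g z) = z" if z: "z \<in> ball (val h x) \<rho>" for z
    proof -
      have zg: "z \<in> dom g" using z b\<rho> g(2) by blast
      have gz: "val g z \<in> ball x \<epsilon>" using z b\<rho> g(3) by auto
      then have "val g z \<in> dom f" using \<epsilon>(2) f(2) by blast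
      moreover have "val g z \<in> dom (map_inverse g)" using zg by (simp add: ran_eq_val_image)
      ultimately have "f (val g z) = map_inverse g (val g z)"
        using S_agree[OF f(1) S_inverse[OF g(1)] ag] by blast
      then show ?thesis using gz val_map_inverse[OF lg zg] by simp
    qed
    have 2: "val g (val f w) = w" if w: "w \<in> O'" "val f w \<in> ball (val h x) \<rho>" for w
    proof -
      have wf: "w \<in> dom f" using w(1) f(2) by blast
      have "val f w \<in> dom g" using w(2) b\<rho> g(2) by blast
      moreover have "val f w \<in> dom ?f'" using wf by (simp add: ran_eq_val_image)
      ultimately have "?f' (val f w) = g (val f w)"
        using S_agree[OF f'(1) g(1,4)] by blast
      then show ?thesis using val_map_inverse[OF lf wf] by simp
    qed
    have "\<forall>w\<in>O'. dist (val f w) (val h w) < \<eta>" using f(3) by simp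
    moreover have "ball (val h x) \<rho> \<subseteq> dom g" using b\<rho> g(2) by (rule order_trans)
    ultimately show ?thesis using f(1,2) g(1) 1 2 by (intro bexI[of _ f] bexI[of _ g]) blast
  qed
  then show thesis using that[of \<rho>] \<rho>(1,2) by blast
qed

text \<open>
  The inverses of the maps approximating \<open>h\<close> extend, by uniform extension, to a fixed ball around
  the image of \<open>x\<close>. Their equicontinuity makes \<open>h\<close> injective, and compactness makes it onto a
  neighbourhood.
\<close>
lemma pg_tilde_local_inverse:
  assumes h: "h \<in> pg_tilde S" and x: "x \<in> dom h"
  obtains U where "open U" "x \<in> U" "U \<subseteq> dom h" "local_homeo (h |` U)" "approximable S (h |` U) U"
    "approximable S (map_inverse (h |` U)) (val h ` U)"
proof -
  obtain O' where O': "open O'" "x \<in> O'" "O' \<subseteq> dom h" "approximable S h O'" "continuous_on O' (val h)"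
    using pg_tildeE[OF h x] .
  let ?y = "val h x"
  obtain l where l: "l > 0" "equicontinuous_at_scale S {x, ?y} l"
    using S_equicontinuous[of "{x, ?y}"] by auto
  have "open (O' \<inter> ball x l)" "x \<in> O' \<inter> ball x l" using O' l by auto
  then obtain r0 where r0: "r0 > 0" "compact (cball x r0)" "cball x r0 \<subseteq> O' \<inter> ball x l"
    using locally_compact_cball[OF locally_compact] by metis
  have r0': "ball x r0 \<subseteq> O'" "ball x r0 \<subseteq> ball x l" using r0(3) ball_subset_cball[of x r0] by blast+
  obtain \<rho>1 where \<rho>1: "\<rho>1 > 0" "\<rho>1 \<le> l"
    "\<And>\<eta>. \<eta> > 0 \<Longrightarrow> \<exists>f\<in>S. \<exists>g\<in>S. O' \<subseteq> dom f \<and> (\<forall>w\<in>O'. dist (val f w) (val h w) < \<eta>) \<and>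
      ball ?y \<rho>1 \<subseteq> dom g \<and> (\<forall>z\<in>ball ?y \<rho>1. val g z \<in> ball x r0 \<and> val f (val g z) = z) \<and>
      (\<forall>w\<in>O'. val f w \<in> ball ?y \<rho>1 \<longrightarrow> val g (val f w) = w)"
    using approximate_inverses[OF O'(2,4) r0(1) r0'(1) l(1)] by metis
  \<comment> \<open>One modulus serves all inverses \<open>g\<close>: they carry points near
    \<open>?y\<close> to points near \<open>x\<close>, and \<open>l\<close> was chosen for both
    centres.\<close>
  have equi: "\<exists>d>0. \<forall>g\<in>S. ball ?y \<rho>1 \<subseteq> dom g \<longrightarrow> (\<forall>z\<in>ball ?y \<rho>1. val g z \<in> ball x r0) \<longrightarrow>
      (\<forall>z\<in>ball ?y \<rho>1. \<forall>z'\<in>ball ?y \<rho>1. dist z z' < d \<longrightarrow> dist (val g z) (val g z') < \<epsilon>)" if "\<epsilon> > 0" for \<epsilon>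
  proof -
    obtain d where d: "d > 0" "\<forall>h\<in>S. \<forall>p\<in>{x, ?y}. \<forall>q\<in>{x, ?y}. \<forall>y\<in>dom h \<inter> ball p l. \<forall>y'\<in>dom h \<inter> ball p l.
       val h y \<in> ball q l \<longrightarrow> val h y' \<in> ball q l \<longrightarrow> dist y y' < d \<longrightarrow> dist (val h y) (val h y') < \<epsilon>"
      using l(2) \<open>\<epsilon> > 0\<close> unfolding equicontinuous_at_scale_def by meson
    have "ball ?y \<rho>1 \<subseteq> ball ?y l" using \<rho>1(2) by auto
    then have "dist (val g z) (val g z') < \<epsilon>" if "g \<in> S" "ball ?y \<rho>1 \<subseteq> dom g"
      "\<forall>z\<in>ball ?y \<rho>1. val g z \<in> ball x r0" "z \<in> ball ?y \<rho>1" "z' \<in> ball ?y \<rho>1" "dist z z' < d" for g z z'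
      using that d(2) r0'(2) by (meson IntI insertI1 insertI2 subsetD)
    then show ?thesis using d(1) by (intro exI[of _ d]) blast
  qed
  obtain r1 where r1: "r1 > 0" "r1 \<le> r0" "\<And>w. w \<in> cball x r1 \<Longrightarrow> dist ?y (val h w) < \<rho>1/2"
  proof -
    have "\<rho>1/2 > 0" using \<rho>1(1) by simp
    then obtain d where d: "d > 0" "\<forall>w\<in>O'. dist w x < d \<longrightarrow> dist (val h w) ?y < \<rho>1/2"
      using O'(2,5) unfolding continuous_on_iff by blast
    have "dist ?y (val h w) < \<rho>1/2" if "w \<in> cball x (min (d/2) r0)" for w
    proof -
      have "w \<in> cball x r0" "dist w x < d" using that d(1) by (auto simp: dist_commute)
      then show ?thesis using d(2) r0(3) by (metis IntD1 dist_commute subsetD)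
    qed
    then show thesis using that[of "min (d/2) r0"] d(1) r0(1) by simp
  qed
  have C: "cball x r1 \<subseteq> O'" using r1(2) r0(3) by auto
  \<comment> \<open>Quantitative injectivity of \<open>h\<close>: the inverses \<open>g\<close> have
    a common modulus and recover \<open>w\<close> from \<open>val f w\<close>. It will also locate
    preimages.\<close>
  have modulus: "\<exists>d>0. \<forall>w\<in>cball x r1. \<forall>w'\<in>cball x r1. dist (val h w) (val h w') < d \<longrightarrow> dist w w' < \<epsilon>"
    if "\<epsilon> > 0" for \<epsilon>
  proof -
    obtain d where d: "d > 0" "\<forall>g\<in>S. ball ?y \<rho>1 \<subseteq> dom g \<longrightarrow> (\<forall>z\<in>ball ?y \<rho>1. val g z \<in> ball x r0) \<longrightarrow>
      (\<forall>z\<in>ball ?y \<rho>1. \<forall>z'\<in>ball ?y \<rho>1. dist z z' < d \<longrightarrow> dist (val g z) (val g z') < \<epsilon>)"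
      using equi[OF \<open>\<epsilon> > 0\<close>] by blast
    \<comment> \<open>The part \<open>\<rho>1/2\<close> keeps \<open>val f w\<close> in the ball
      where \<open>g\<close> inverts \<open>f\<close>; two errors \<open>d/3\<close> and the
      distance of the \<open>h\<close>-values add up to less than \<open>d\<close>.\<close>
    have "min (d/3) (\<rho>1/2) > 0" using d(1) \<rho>1(1) by simp
    from \<rho>1(3)[OF this] obtain f g where fg: "f \<in> S" "g \<in> S"
      "\<forall>w\<in>O'. dist (val f w) (val h w) < min (d/3) (\<rho>1/2)" "ball ?y \<rho>1 \<subseteq> dom g"
      "\<forall>z\<in>ball ?y \<rho>1. val g z \<in> ball x r0 \<and> val f (val g z) = z"
      "\<forall>w\<in>O'. val f w \<in> ball ?y \<rho>1 \<longrightarrow> val g (val f w) = w"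
      by blast
    have *: "val f w \<in> ball ?y \<rho>1 \<and> val g (val f w) = w \<and> dist (val f w) (val h w) < d/3"
      if "w \<in> cball x r1" for w
    proof -
      have w: "w \<in> O'" using that C by blast
      then have "dist (val f w) (val h w) < min (d/3) (\<rho>1/2)" using fg(3) by blast
      moreover have "val f w \<in> ball ?y \<rho>1" using calculation r1(3)[OF that] unfolding mem_ball by metric
      ultimately show ?thesis using fg(6) w by simp
    qed
    have "dist w w' < \<epsilon>" if "w \<in> cball x r1" "w' \<in> cball x r1" "dist (val h w) (val h w') < d/3" for w w'
    proof -
      have "dist (val f w) (val f w') < d" using *[OF that(1)] *[OF that(2)] that(3) by metric
      then have "dist (val g (val f w)) (val g (val f w')) < \<epsilon>"
        using d(2) fg(2,4,5) *[OF that(1)] *[OF that(2)] by blast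
      then show ?thesis using *[OF that(1)] *[OF that(2)] by simp
    qed
    then show ?thesis using d(1) by (intro exI[of _ "d/3"]) simp
  qed
  have r1h: "r1/2 > 0" "ball x (r1/2) \<subseteq> O'" using r1(1) C by auto
  have "\<rho>1/2 > 0" using \<rho>1(1) by simp
  \<comment> \<open>A second family of inverses with a smaller target: the preimages now lie in a
    compact ball on which \<open>modulus\<close> applies.\<close>
  then obtain \<rho>2 where \<rho>2: "\<rho>2 > 0" "\<rho>2 \<le> \<rho>1/2"
    "\<And>\<eta>. \<eta> > 0 \<Longrightarrow> \<exists>f\<in>S. \<exists>g\<in>S. O' \<subseteq> dom f \<and> (\<forall>w\<in>O'. dist (val f w) (val h w) < \<eta>) \<and>
      ball ?y \<rho>2 \<subseteq> dom g \<and> (\<forall>z\<in>ball ?y \<rho>2. val g z \<in> ball x (r1/2) \<and> val f (val g z) = z) \<and>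
      (\<forall>w\<in>O'. val f w \<in> ball ?y \<rho>2 \<longrightarrow> val g (val f w) = w)"
    using approximate_inverses[OF O'(2,4) r1h] by metis
  \<comment> \<open>A missed value \<open>z\<close> would have positive distance \<open>e\<close>
    from the compact image. But \<open>f\<close> sends \<open>val g z\<close> exactly to
    \<open>z\<close>, and \<open>h\<close> differs from \<open>f\<close> there by less than
    \<open>e\<close>.\<close>
  have onto: "z \<in> val h ` cball x (r1/2)" if z: "z \<in> ball ?y \<rho>2" for z
  proof (rule ccontr)
    let ?A = "val h ` cball x (r1/2)"
    assume "z \<notin> ?A"
    have sub: "cball x (r1/2) \<subseteq> O'" using C r1(1) by auto
    have "cball x r0 \<inter> cball x (r1/2) = cball x (r1/2)" using r1(1,2) by auto
    then have "compact (cball x (r1/2))" using compact_Int_closed[OF r0(2) closed_cball] by metis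
    then have "compact ?A"
      by (rule compact_continuous_image[OF continuous_on_subset[OF O'(5) sub]])
    then have "open (- ?A)" using compact_imp_closed by blast
    then obtain e where e: "e > 0" "ball z e \<subseteq> - ?A"
      using \<open>z \<notin> ?A\<close> openE[of "- ?A" z] by blast
    obtain f g where fg: "\<forall>w\<in>O'. dist (val f w) (val h w) < e"
      "\<forall>z\<in>ball ?y \<rho>2. val g z \<in> ball x (r1/2) \<and> val f (val g z) = z"
      using \<rho>2(3)[OF e(1)] by blast
    have "val g z \<in> cball x (r1/2)" "val f (val g z) = z" using bspec[OF fg(2) z] by auto
    moreover from this have "dist z (val h (val g z)) < e" using bspec[OF fg(1), of "val g z"] sub by auto
    ultimately show False using e(2) by (metis ComplD imageI mem_ball subsetD)
  qed
  define U where "U = ball x r1 \<inter> (val h -` ball ?y \<rho>2 \<inter> O')"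
  have U: "open U" "x \<in> U" "U \<subseteq> dom h" "U \<subseteq> cball x r1" "U \<subseteq> O'"
  proof -
    have "open (val h -` ball ?y \<rho>2 \<inter> O')"
      using continuous_on_open_vimage[OF O'(1)] O'(5) open_ball by blast
    then show "open U" unfolding U_def by blast
    show "x \<in> U" unfolding U_def using r1(1) \<rho>2(1) O'(2) by simp
    show "U \<subseteq> O'" "U \<subseteq> cball x r1" unfolding U_def by auto
    then show "U \<subseteq> dom h" using O'(3) by blast
  qed
  have domk: "dom (h |` U) = U" using U(3) unfolding dom_restrict by blast
  have im: "val (h |` U) ` V = val h ` V" if "V \<subseteq> U" for V
    using that by (intro image_cong) auto
  have "local_homeo (h |` U)"
    unfolding local_homeo_iff domk
  proof (intro conjI allI impI)
    show "open U" by fact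
    show "continuous_on U (val (h |` U))"
      by (rule continuous_on_eq[OF continuous_on_subset[OF O'(5) U(5)]]) simp
    show "inj_on (val (h |` U)) U"
    proof (rule inj_onI)
      fix w w' assume w: "w \<in> U" "w' \<in> U" "val (h |` U) w = val (h |` U) w'"
      then have eq: "val h w = val h w'" by simp
      have C': "w \<in> cball x r1" "w' \<in> cball x r1" using w U(4) by blast+
      show "w = w'"
      proof (rule ccontr)
        assume "w \<noteq> w'"
        then have "dist w w' > 0" by simp
        from modulus[OF this] C' eq show False by fastforce
      qed
    qed
    fix V assume V: "open V" "V \<subseteq> U"
    have "open (val h ` V)"
    proof (subst open_subopen, rule ballI)
      fix z assume "z \<in> val h ` V"
      then obtain w where w: "w \<in> V" "z = val h w" by blast
      obtain e where e: "e > 0" "ball w e \<subseteq> V" using openE[OF V(1) w(1)] by blast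
      obtain d where d: "d > 0" "\<forall>w\<in>cball x r1. \<forall>w'\<in>cball x r1. dist (val h w) (val h w') < d \<longrightarrow> dist w w' < e"
        using modulus[OF e(1)] by blast
      \<comment> \<open>\<open>onto\<close> gives a preimage for each point of \<open>?T\<close>,
        and \<open>modulus\<close> forces it into \<open>ball w e\<close>.\<close>
      let ?T = "ball z d \<inter> ball ?y \<rho>2"
      have "?T \<subseteq> val h ` V"
      proof
        fix z' assume z': "z' \<in> ?T"
        then obtain w' where w': "w' \<in> cball x (r1/2)" "z' = val h w'" using onto by blast
        have "w \<in> cball x r1" "w' \<in> cball x r1" using w(1) V(2) U(4) w'(1) r1(1) by auto
        moreover have "dist (val h w) (val h w') < d" using z' w w' by simp
        ultimately have "w' \<in> ball w e" using d(2) by simp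
        then show "z' \<in> val h ` V" using e(2) w'(2) by blast
      qed
      moreover have "w \<in> U" using w(1) V(2) by blast
      then have "z \<in> ?T" using w(2) d(1) unfolding U_def by simp
      ultimately show "\<exists>T. open T \<and> z \<in> T \<and> T \<subseteq> val h ` V" by (intro exI[of _ ?T]) auto
    qed
    then show "open (val (h |` U) ` V)" using im[OF V(2)] by simp
  qed
  moreover from this have inv: "val (map_inverse (h |` U)) (val h w) = w" if "w \<in> U" for w
    using val_map_inverse[of "h |` U" w] that U(3) by (simp add: subsetD)
  have "approximable S (map_inverse (h |` U)) (val h ` U)"
    unfolding approximable_def
  proof (intro allI impI)
    fix \<epsilon> :: real assume "\<epsilon> > 0"
    then obtain d where d: "d > 0" "\<forall>g\<in>S. ball ?y \<rho>1 \<subseteq> dom g \<longrightarrow> (\<forall>z\<in>ball ?y \<rho>1. val g z \<in> ball x r0) \<longrightarrow>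
      (\<forall>z\<in>ball ?y \<rho>1. \<forall>z'\<in>ball ?y \<rho>1. dist z z' < d \<longrightarrow> dist (val g z) (val g z') < \<epsilon>)"
      using equi by blast
    have "min d (\<rho>1/2) > 0" using d(1) \<rho>1(1) by simp
    from \<rho>1(3)[OF this] obtain f g where fg: "f \<in> S" "g \<in> S"
      "\<forall>w\<in>O'. dist (val f w) (val h w) < min d (\<rho>1/2)" "ball ?y \<rho>1 \<subseteq> dom g"
      "\<forall>z\<in>ball ?y \<rho>1. val g z \<in> ball x r0 \<and> val f (val g z) = z"
      "\<forall>w\<in>O'. val f w \<in> ball ?y \<rho>1 \<longrightarrow> val g (val f w) = w"
      by blast
    have hw: "val h w \<in> ball ?y \<rho>1" "dist ?y (val h w) < \<rho>1/2" if "w \<in> U" for w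
    proof -
      show "dist ?y (val h w) < \<rho>1/2" using that \<rho>2(2) unfolding U_def by simp
      then show "val h w \<in> ball ?y \<rho>1" using \<rho>1(1) by simp
    qed
    \<comment> \<open>\<open>g\<close> returns \<open>val f w\<close> exactly to \<open>w\<close>;
      its modulus absorbs the difference between \<open>val f w\<close> and
      \<open>val h w\<close>.\<close>
    have "dist (val g (val h w)) w < \<epsilon>" if w: "w \<in> U" for w
    proof -
      have wO: "w \<in> O'" using w U(5) by blast
      have fw: "dist (val f w) (val h w) < min d (\<rho>1/2)" using fg(3) wO by blast
      have f1: "val f w \<in> ball ?y \<rho>1" using fw hw(2)[OF w] unfolding mem_ball by metric
      have "dist (val h w) (val f w) < d" using fw by (simp add: dist_commute)
      then have "dist (val g (val h w)) (val g (val f w)) < \<epsilon>"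
        using d(2) fg(2,4,5) hw(1)[OF w] f1 by blast
      then show ?thesis using fg(6) wO f1 by simp
    qed
    then have "\<forall>z\<in>val h ` U. dist (val g z) (val (map_inverse (h |` U)) z) < \<epsilon>" using inv by auto
    moreover have "val h ` U \<subseteq> dom g" using hw(1) fg(4) by blast
    ultimately show "\<exists>f\<in>S. val h ` U \<subseteq> dom f \<and> (\<forall>z\<in>val h ` U. dist (val f z) (val (map_inverse (h |` U)) z) < \<epsilon>)"
      using fg(2) by blast
  qed
  moreover have "approximable S (h |` U) U"
    by (rule approximable_mono[OF O'(4) U(5) order_refl]) simp
  ultimately show thesis using that U(1-3) by blast
qed

end

section \<open>Orbits of the closure\<close>

text \<open>By Tychonoff's theorem the functions into \<open>C\<close> are compact for pointwise
  convergence, so the closures of all tails have a common point. A cluster point suffices, without a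
  convergent subsequence; \<open>N\<close> makes arbitrarily large indices available.\<close>

lemma pointwise_cluster_point:
  fixes f :: "nat \<Rightarrow> 'a \<Rightarrow> 'b::metric_space"
  assumes C: "compact C" "\<And>n z. f n z \<in> C"
  obtains h where "\<And>A \<eta> N. finite A \<Longrightarrow> \<eta> > 0 \<Longrightarrow> \<exists>n\<ge>N. \<forall>a\<in>A. dist (f n a) (h a) < \<eta>"
proof -
  have "compactin (product_topology (\<lambda>i::'a. euclidean :: 'b topology) UNIV) (PiE UNIV (\<lambda>_. C))"
    using C(1) by (simp add: compactin_PiE)
  then have "compact (PiE UNIV (\<lambda>_::'a. C))" unfolding euclidean_product_topology by simp
  then have "PiE UNIV (\<lambda>_. C) \<inter> (\<Inter>n\<in>UNIV. closure (f ` {n..})) \<noteq> {}"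
  proof (rule compact_imp_fip_image)
    fix I' :: "nat set" assume "finite I'"
    then obtain m where "\<forall>n\<in>I'. n \<le> m" by (auto simp: finite_nat_set_iff_bounded_le)
    then have "f m \<in> PiE UNIV (\<lambda>_. C) \<inter> (\<Inter>n\<in>I'. closure (f ` {n..}))"
      using C(2) closure_subset by fastforce
    then show "PiE UNIV (\<lambda>_. C) \<inter> (\<Inter>n\<in>I'. closure (f ` {n..})) \<noteq> {}" by blast
  qed simp
  then obtain h where h: "\<And>n. h \<in> closure (f ` {n..})" by blast
  have "\<exists>n\<ge>N. \<forall>a\<in>A. dist (f n a) (h a) < \<eta>" if A: "finite A" "\<eta> > 0" for A \<eta> N
  proof -
    let ?W = "\<Inter>a\<in>A. (\<lambda>k. k a) -` ball (h a) \<eta>"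
    have "open ?W"
      by (intro open_INT ballI A(1) open_vimage open_ball continuous_on_product_coordinates)
    moreover have "h \<in> ?W" using A(2) by simp
    ultimately have "?W \<inter> f ` {N..} \<noteq> {}"
      using h[of N] open_Int_closure_eq_empty[of ?W "f ` {N..}"] by blast
    then show ?thesis by (fastforce simp: dist_commute)
  qed
  then show thesis using that by blast
qed

context admissible_pseudogroup
begin

lemma pg_bar_restrict:
  assumes h: "h \<in> pg_tilde S" "open U" "local_homeo (h |` U)"
  shows "h |` U \<in> pg_bar S"
  unfolding pg_bar_def using pg_tilde_restrict h by blast

text \<open>
  An Arzela-Ascoli argument: generators sending \<open>x\<close> close to \<open>y\<close> extend to a common ball, and
  equicontinuity turns a pointwise cluster point of them into a uniform limit.
\<close>
lemma closure_orbit_subset: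
  assumes y: "y \<in> closure (orbit H x)"
  shows "y \<in> orbit (pg_bar S) x"
proof -
  obtain l where l: "l > 0" "equicontinuous_at_scale S {x, y} l"
    using S_equicontinuous[of "{x, y}"] by auto
  obtain r where r: "r > 0" "compact (cball y r)" "cball y r \<subseteq> ball y l"
    using locally_compact_cball[OF locally_compact open_ball, of y y l] l(1) by auto
  obtain \<rho>' where \<rho>': "\<rho>' > 0" "\<forall>g\<in>S. \<forall>z\<in>dom g. dist x z < \<rho>' \<longrightarrow> dist y (val g z) < \<rho>' \<longrightarrow>
    (\<exists>f\<in>S. ball x \<rho>' \<subseteq> dom f \<and> (\<forall>z\<in>ball x \<rho>'. dist y (val f z) < r) \<and> agree_near z g f)"
    using uniform_extension[OF r(1), of x y] by blast
  have "x \<in> ball x (min \<rho>' l)" using \<rho>'(1) l(1) by simp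
  then obtain \<rho> where \<rho>: "\<rho> > 0" "compact (cball x \<rho>)" "cball x \<rho> \<subseteq> ball x (min \<rho>' l)"
    using locally_compact_cball[OF locally_compact open_ball] by metis
  have "\<exists>f\<in>S. ball x \<rho>' \<subseteq> dom f \<and> (\<forall>z\<in>ball x \<rho>'. dist y (val f z) < r) \<and> dist (val f x) y < \<delta>"
    if "\<delta> > 0" for \<delta>
  proof -
    have "min \<delta> \<rho>' > 0" using that \<rho>'(1) by simp
    then obtain z where z: "z \<in> orbit H x" "dist z y < min \<delta> \<rho>'"
      using y closure_approachable by blast
    then obtain g where g: "g \<in> H" "g x = Some z" unfolding orbit_def by blast
    then obtain O' where O': "x \<in> O'" "g |` O' \<in> S" using H_germ[OF g(1), of x] by blast
    have gx: "x \<in> dom (g |` O')" "val (g |` O') x = z" using O'(1) g(2) by auto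
    then obtain f where f: "f \<in> S" "ball x \<rho>' \<subseteq> dom f" "\<forall>z\<in>ball x \<rho>'. dist y (val f z) < r"
      "agree_near x (g |` O') f"
      using \<rho>' O'(2) z(2) by (metis dist_commute dist_self min_less_iff_conj)
    have "val f x = z" using agree_nearD[OF f(4)] gx by simp
    then show ?thesis using f z(2) by (intro bexI[of _ f]) auto
  qed
  then have "\<exists>f\<in>S. ball x \<rho>' \<subseteq> dom f \<and> (\<forall>z\<in>ball x \<rho>'. dist y (val f z) < r) \<and>
      dist (val f x) y < inverse (Suc n)" for n
    by simp
  then obtain F where F: "\<And>n. F n \<in> S" "\<And>n. ball x \<rho>' \<subseteq> dom (F n)"
    "\<And>n z. z \<in> ball x \<rho>' \<Longrightarrow> dist y (val (F n) z) < r" "\<And>n. dist (val (F n) x) y < inverse (Suc n)"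
    by metis
  \<comment> \<open>The default \<open>y\<close> off the common ball makes the maps total with
    values in the compact \<open>cball y r\<close>.\<close>
  define f where "f = (\<lambda>n z. if z \<in> ball x \<rho>' then val (F n) z else y)"
  have "f n z \<in> cball y r" for n z using F(3)[of z n] r(1) by (auto simp: f_def)
  with r(2) obtain k where k: "\<And>A \<eta> N. finite A \<Longrightarrow> \<eta> > 0 \<Longrightarrow> \<exists>n\<ge>N. \<forall>a\<in>A. dist (f n a) (k a) < \<eta>"
    using pointwise_cluster_point[of "cball y r" f] by metis
  \<comment> \<open>The cluster point inherits the modulus up to the factor 3: compare it with one
    \<open>f n\<close> at both points.\<close>
  have equi: "\<exists>d>0. \<forall>n. \<forall>z\<in>cball x \<rho>. \<forall>z'\<in>cball x \<rho>. dist z z' < d \<longrightarrow>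
    dist (f n z) (f n z') < \<epsilon> \<and> dist (k z) (k z') < 3 * \<epsilon>" if "\<epsilon> > 0" for \<epsilon>
  proof -
    obtain d where d: "d > 0" "\<forall>h\<in>S. \<forall>p\<in>{x, y}. \<forall>q\<in>{x, y}. \<forall>a\<in>dom h \<inter> ball p l. \<forall>b\<in>dom h \<inter> ball p l.
       val h a \<in> ball q l \<longrightarrow> val h b \<in> ball q l \<longrightarrow> dist a b < d \<longrightarrow> dist (val h a) (val h b) < \<epsilon>"
      using l(2) \<open>\<epsilon> > 0\<close> unfolding equicontinuous_at_scale_def by meson
    have 1: "dist (f n z) (f n z') < \<epsilon>" if "z \<in> cball x \<rho>" "z' \<in> cball x \<rho>" "dist z z' < d" for n z z'
    proof -
      have b: "z \<in> ball x \<rho>'" "z \<in> ball x l" "z' \<in> ball x \<rho>'" "z' \<in> ball x l"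
        using that(1,2) \<rho>(3) by auto
      moreover have "z \<in> dom (F n)" "z' \<in> dom (F n)" using b F(2) by blast+
      moreover have "val (F n) z \<in> ball y l" "val (F n) z' \<in> ball y l"
        using F(3)[OF b(1), of n] F(3)[OF b(3), of n] subsetD[OF r(3)] by simp_all
      ultimately have "dist (val (F n) z) (val (F n) z') < \<epsilon>"
        using d(2) F(1)[of n] that(3) by blast
      then show ?thesis using b by (simp add: f_def)
    qed
    have "dist (k z) (k z') < 3 * \<epsilon>" if z: "z \<in> cball x \<rho>" "z' \<in> cball x \<rho>" "dist z z' < d" for z z'
    proof -
      obtain n where n: "\<forall>a\<in>{z, z'}. dist (f n a) (k a) < \<epsilon>" using k[of "{z, z'}" \<epsilon> 0] \<open>\<epsilon> > 0\<close> by auto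
      then have "dist (f n z) (k z) < \<epsilon>" "dist (f n z') (k z') < \<epsilon>" by auto
      with 1[OF z, of n] show ?thesis by metric
    qed
    with 1 show ?thesis using d(1) by (intro exI[of _ d]) blast
  qed
  let ?W = "ball x \<rho>"
  have W: "?W \<subseteq> cball x \<rho>" "?W \<subseteq> ball x \<rho>'"
    using order_trans[OF ball_subset_cball \<rho>(3)] by auto
  define h where "h = (\<lambda>z. if z \<in> ?W then Some (k z) else None)"
  have dh: "dom h = ?W" and vh: "\<And>z. z \<in> ?W \<Longrightarrow> val h z = k z"
    by (auto simp: h_def split: if_splits)
  have "approximable S h ?W"
    unfolding approximable_def
  proof (intro allI impI)
    fix \<epsilon> :: real assume "\<epsilon> > 0"
    then have \<epsilon>: "\<epsilon>/6 > 0" by simp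
    from equi[OF this] obtain d where d: "d > 0" "\<forall>n. \<forall>z\<in>cball x \<rho>. \<forall>z'\<in>cball x \<rho>. dist z z' < d \<longrightarrow>
      dist (f n z) (f n z') < \<epsilon>/6 \<and> dist (k z) (k z') < 3 * (\<epsilon>/6)"
      by blast
    \<comment> \<open>A finite net turns closeness at finitely many points into uniform closeness.
      The errors are \<open>\<epsilon>/6\<close> for \<open>f n\<close>, \<open>\<epsilon>/6\<close>
      at the net point and \<open>3 * (\<epsilon>/6)\<close> for \<open>k\<close>, together less
      than \<open>\<epsilon>\<close>.\<close>
    have cover: "cball x \<rho> \<subseteq> (\<Union>a\<in>cball x \<rho>. ball a d)" using d(1) by force
    obtain A where A: "A \<subseteq> cball x \<rho>" "finite A" "cball x \<rho> \<subseteq> (\<Union>a\<in>A. ball a d)"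
      by (rule compactE_image[OF \<rho>(2) open_ball cover])
    obtain n where n: "\<forall>a\<in>A. dist (f n a) (k a) < \<epsilon>/6" using k[OF A(2) \<epsilon>, of 0] by blast
    have "dist (val (F n) z) (val h z) < \<epsilon>" if z: "z \<in> ?W" for z
    proof -
      obtain a where a: "a \<in> A" "dist a z < d" using subsetD[OF order_trans[OF W(1) A(3)] z] by auto
      have "dist (f n a) (f n z) < \<epsilon>/6 \<and> dist (k a) (k z) < 3 * (\<epsilon>/6)"
        using d(2) a A(1) W(1) z by blast
      moreover have "dist (f n a) (k a) < \<epsilon>/6" using n a(1) by blast
      ultimately have "dist (f n z) (k z) < \<epsilon>" by metric
      moreover have "f n z = val (F n) z" using z W(2) by (auto simp: f_def)
      ultimately show ?thesis using vh[OF z] by simp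
    qed
    moreover have "?W \<subseteq> dom (F n)" using W(2) F(2) by (rule order_trans)
    ultimately show "\<exists>f\<in>S. ?W \<subseteq> dom f \<and> (\<forall>z\<in>?W. dist (val f z) (val h z) < \<epsilon>)"
      using F(1) by blast
  qed
  moreover have "open ?W" by simp
  ultimately have ht: "h \<in> pg_tilde S" unfolding pg_tilde_iff dh by blast
  have xh: "x \<in> dom h" using dh \<rho>(1) by simp
  \<comment> \<open>Large indices matter here: \<open>val (F n) x\<close> tends to \<open>y\<close>,
    while \<open>k\<close> is approached at \<open>x\<close> along arbitrarily large
    \<open>n\<close>.\<close>
  have "k x = y"
  proof (rule ccontr)
    assume "k x \<noteq> y"
    then have \<eta>: "dist (k x) y / 2 > 0" by simp
    obtain N where N: "inverse (Suc N) < dist (k x) y / 2" using reals_Archimedean[OF \<eta>] by blast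
    obtain n where n: "n \<ge> N" "dist (f n x) (k x) < dist (k x) y / 2" using k[of "{x}", OF _ \<eta>, of N] by auto
    have "inverse (real (Suc n)) \<le> inverse (real (Suc N))" using n(1) by (intro le_imp_inverse_le) simp_all
    then have "dist (val (F n) x) y < dist (k x) y / 2" using F(4)[of n] N by linarith
    then have "dist (f n x) y < dist (k x) y / 2" using \<rho>'(1) by (simp add: f_def)
    with n(2) show False by metric
  qed
  then have hx: "h x = Some y" using \<rho>(1) by (simp add: h_def)
  \<comment> \<open>The limit \<open>h\<close> is known only to lie in \<open>pg_tilde S\<close>; a
    restriction near \<open>x\<close> is a homeomorphism and so belongs to
    \<open>pg_bar S\<close>.\<close>
  obtain U where "open U" "x \<in> U" "local_homeo (h |` U)" using pg_tilde_local_inverse[OF ht xh] by metis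
  then have "h |` U \<in> pg_bar S" "(h |` U) x = Some y" using pg_bar_restrict[OF ht] hx by auto
  then show ?thesis unfolding orbit_def by blast
qed

lemma orbit_pg_bar: "orbit (pg_bar S) x = closure (orbit H x)"
proof
  show "orbit (pg_bar S) x \<subseteq> closure (orbit H x)"
  proof
    fix y assume "y \<in> orbit (pg_bar S) x"
    then obtain h where h: "h \<in> pg_tilde S" "h x = Some y" unfolding orbit_def pg_bar_def by blast
    then obtain O' where O': "x \<in> O'" "approximable S h O'" using pg_tildeE[OF h(1), of x] by blast
    show "y \<in> closure (orbit H x)"
      unfolding closure_approachable
    proof (intro allI impI)
      fix e :: real assume "e > 0"
      from approximableE[OF O'(2) this] obtain f where f: "f \<in> S" "O' \<subseteq> dom f"
        "\<forall>y\<in>O'. dist (val f y) (val h y) < e" .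
      then have "val f x \<in> orbit H x" using S_subset_H O'(1) unfolding orbit_def by fastforce
      moreover have "dist (val f x) y < e" using bspec[OF f(3) O'(1)] h(2) by simp
      ultimately show "\<exists>z\<in>orbit H x. dist z y < e" by blast
    qed
  qed
  show "closure (orbit H x) \<subseteq> orbit (pg_bar S) x" using closure_orbit_subset by blast
qed

section \<open>The closure is a strongly equicontinuous pseudogroup\<close>

lemma H_subset_pg_bar: "H \<subseteq> pg_bar S"
proof
  fix h assume h: "h \<in> H"
  have "h \<in> pg_tilde S"
    unfolding pg_tilde_iff
  proof
    fix x assume "x \<in> dom h"
    then obtain O' where O': "open O'" "x \<in> O'" "O' \<subseteq> dom h" "h |` O' \<in> S" using H_germ[OF h] by blast
    have "approximable S h O'" unfolding approximable_def
      using O'(3,4) by (intro allI impI bexI[of _ "h |` O'"]) auto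
    then show "\<exists>O'. open O' \<and> x \<in> O' \<and> O' \<subseteq> dom h \<and> approximable S h O'" using O' by blast
  qed
  then show "h \<in> pg_bar S" using H_local_homeo[OF h] by (simp add: pg_bar_def)
qed

text \<open>Near \<open>val h x\<close>, the inverse of \<open>h\<close> coincides with the inverse
  of a restriction of \<open>h\<close>, which \<open>pg_tilde_local_inverse\<close> approximates by
  \<open>S\<close>.\<close>

lemma pg_bar_inverse:
  assumes "h \<in> pg_bar S"
  shows "map_inverse h \<in> pg_bar S"
proof -
  have h: "h \<in> pg_tilde S" "local_homeo h" using assms by (auto simp: pg_bar_def)
  have "map_inverse h \<in> pg_tilde S"
    unfolding pg_tilde_iff
  proof
    fix y assume "y \<in> dom (map_inverse h)"
    then obtain x where x: "x \<in> dom h" "y = val h x" by (auto simp: ran_eq_val_image)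
    obtain U where U: "open U" "x \<in> U" "U \<subseteq> dom h" "local_homeo (h |` U)"
      "approximable S (map_inverse (h |` U)) (val h ` U)"
      using pg_tilde_local_inverse[OF h(1) x(1)] by metis
    have "approximable S (map_inverse h) (val h ` U)"
    proof (rule approximable_mono[OF U(5)])
      fix z assume "z \<in> val h ` U"
      then obtain w where w: "w \<in> U" "z = val h w" by blast
      then have wd: "w \<in> dom h" using U(3) by blast
      then have "w \<in> dom (h |` U)" "val (h |` U) w = z" using w by auto
      then have "val (map_inverse (h |` U)) z = w" using val_map_inverse[OF U(4)] by metis
      moreover have "val (map_inverse h) z = w" using val_map_inverse[OF h(2) wd] w(2) by simp
      ultimately show "val (map_inverse (h |` U)) z = val (map_inverse h) z" by simp
    qed auto
    moreover have "open (val h ` U)" using local_homeoD(4)[OF h(2) U(1,3)] .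
    moreover have "y \<in> val h ` U" using x(2) U(2) by blast
    moreover have "val h ` U \<subseteq> dom (map_inverse h)"
      using U(3) unfolding dom_map_inverse ran_eq_val_image by blast
    ultimately show "\<exists>O'. open O' \<and> y \<in> O' \<and> O' \<subseteq> dom (map_inverse h) \<and> approximable S (map_inverse h) O'"
      by blast
  qed
  then show ?thesis using local_homeo_inverse[OF h(2)] by (simp add: pg_bar_def)
qed

lemma pseudogroup_pg_bar: "pseudogroup (pg_bar S)"
proof -
  have "Some \<in> H" using pseudogroup by (simp add: pseudogroup_def)
  then have "Some \<in> pg_bar S" using H_subset_pg_bar by blast
  moreover have "symmetric_maps (pg_bar S)" using pg_bar_inverse by (simp add: symmetric_maps_def)
  ultimately show ?thesis
    unfolding pseudogroup_def closed_under_composition_def closed_under_restriction_def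
    using local_homeo_comp local_homeo_restrict pg_tilde_comp pg_tilde_restrict
    by (auto simp: pg_bar_def intro: pg_tilde_combination)
qed

text \<open>Compact sets are the compromise: approximation on them survives composition, and they
  include every pair of points of the domain, so that one map of \<open>S\<close> can be close to
  \<open>h\<close> at both.\<close>

definition compactly_approximable :: "('a \<rightharpoonup> 'a) \<Rightarrow> bool" where
  "compactly_approximable h \<longleftrightarrow> (\<forall>K. compact K \<longrightarrow> K \<subseteq> dom h \<longrightarrow> approximable S h K)"

lemma compactly_approximable_comp:
  assumes g: "compactly_approximable g" "local_homeo g" and h: "compactly_approximable h" "local_homeo h"
  shows "compactly_approximable (g \<circ>\<^sub>m h)"
  unfolding compactly_approximable_def
proof (intro allI impI)
  fix K assume K: "compact K" "K \<subseteq> dom (g \<circ>\<^sub>m h)"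
  have Kh: "K \<subseteq> dom h" "val h ` K \<subseteq> dom g" using K(2) by (auto simp: dom_map_comp)
  have "compact (val h ` K)"
    using compact_continuous_image[OF continuous_on_subset[OF local_homeoD(2)[OF h(2)] Kh(1)] K(1)] .
  then obtain C r where C: "r > 0" "compact C" "C \<subseteq> dom g" "\<And>x. x \<in> val h ` K \<Longrightarrow> ball x r \<subseteq> C"
    using compact_open_nbhd[OF locally_compact _ local_homeoD(1)[OF g(2)] Kh(2)] by metis
  show "approximable S (g \<circ>\<^sub>m h) K"
  proof (rule approximable_comp[OF S_closed_comp C(2) _ _ _ Kh(1) C(1)])
    show "continuous_on C (val g)" using continuous_on_subset[OF local_homeoD(2)[OF g(2)] C(3)] .
    show "approximable S g C" using g(1) C unfolding compactly_approximable_def by blast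
    show "approximable S h K" using h(1) K(1) Kh(1) unfolding compactly_approximable_def by blast
    show "ball (val h y) r \<subseteq> C" if "y \<in> K" for y using C(4) that by blast
  qed
qed

text \<open>The condition on the inverse is built in to make the set symmetric.\<close>

definition bar_generators :: "('a \<rightharpoonup> 'a) set" where
  "bar_generators =
    {h. local_homeo h \<and> compactly_approximable h \<and> compactly_approximable (map_inverse h)}"

text \<open>Every germ of the closure is represented on an open set where the map and its inverse
  are uniform limits of maps in \<open>S\<close>, hence limits on compact subsets.\<close>

lemma generates_bar_generators: "generates bar_generators (pg_bar S)"
  unfolding generates_def
proof
  show "bar_generators \<subseteq> pg_bar S"
  proof
    fix h assume h: "h \<in> bar_generators"
    then have lh: "local_homeo h" by (simp add: bar_generators_def)
    have "h \<in> pg_tilde S"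
      unfolding pg_tilde_iff
    proof
      fix x assume "x \<in> dom h"
      then obtain r where r: "r > 0" "compact (cball x r)" "cball x r \<subseteq> dom h"
        using locally_compact_cball[OF locally_compact local_homeoD(1)[OF lh]] by blast
      then have "approximable S h (cball x r)"
        using h by (auto simp: bar_generators_def compactly_approximable_def)
      then have "approximable S h (ball x r)"
        by (rule approximable_mono[OF _ ball_subset_cball order_refl]) simp
      then show "\<exists>O'. open O' \<and> x \<in> O' \<and> O' \<subseteq> dom h \<and> approximable S h O'"
        using r(1,3) ball_subset_cball[of x r] by (intro exI[of _ "ball x r"]) force
    qed
    then show "h \<in> pg_bar S" using lh by (simp add: pg_bar_def)
  qed
  show "pg_bar S \<subseteq> generated bar_generators"
  proof
    fix h assume "h \<in> pg_bar S"
    then have h: "h \<in> pg_tilde S" "local_homeo h" by (auto simp: pg_bar_def)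
    show "h \<in> generated bar_generators"
    proof (rule generated_of_germs[OF h(2)])
      fix x assume "x \<in> dom h"
      then obtain U where U: "open U" "x \<in> U" "U \<subseteq> dom h" "local_homeo (h |` U)"
        "approximable S (h |` U) U" "approximable S (map_inverse (h |` U)) (val h ` U)"
        using pg_tilde_local_inverse[OF h(1)] by metis
      have d: "dom (h |` U) = U" using U(3) unfolding dom_restrict by blast
      have "val (h |` U) ` U = val h ` U" by (intro image_cong) auto
      then have r: "ran (h |` U) = val h ` U" unfolding ran_eq_val_image d .
      have "compactly_approximable (h |` U)" "compactly_approximable (map_inverse (h |` U))"
        unfolding compactly_approximable_def d dom_map_inverse r
        using approximable_mono[OF U(5) _ order_refl] approximable_mono[OF U(6) _ order_refl] by blast+
      then show "\<exists>O'. open O' \<and> x \<in> O' \<and> h |` O' \<in> bar_generators"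
        using U(1,2,4) unfolding bar_generators_def by blast
    qed
  qed
qed

text \<open>The cover stays the same, and \<open>\<delta>\<close> is the one that \<open>S\<close>
  has for \<open>\<epsilon>/2\<close>. For each pair of points, a map of \<open>S\<close> close to
  \<open>h\<close> at both keeps the images inside the open metric space \<open>n\<close>; two
  errors of \<open>\<epsilon>/4\<close> complete the estimate.\<close>

lemma equicontinuous_bar_generators:
  assumes D: "open_metric_cover D" "equicontinuous_wrt D S"
  shows "equicontinuous_wrt D bar_generators"
  unfolding equicontinuous_wrt_def
proof (intro allI impI)
  fix \<epsilon> :: real assume "\<epsilon> > 0"
  then have \<epsilon>: "\<epsilon>/2 > 0" "\<epsilon>/4 > 0" by auto
  obtain \<delta> where \<delta>: "\<delta> > 0" "\<forall>h\<in>S. \<forall>m\<in>D. \<forall>n\<in>D. \<forall>x y x' y'.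
     x \<in> mspace m \<and> y \<in> mspace m \<and> h x = Some x' \<and> h y = Some y' \<and>
     x' \<in> mspace n \<and> y' \<in> mspace n \<and> mdist m x y < \<delta> \<longrightarrow> mdist n x' y' < \<epsilon>/2"
    using D(2) \<epsilon>(1) unfolding equicontinuous_wrt_def by blast
  show "\<exists>\<delta>>0. \<forall>h\<in>bar_generators. \<forall>m\<in>D. \<forall>n\<in>D. \<forall>x y x' y'.
     x \<in> mspace m \<and> y \<in> mspace m \<and> h x = Some x' \<and> h y = Some y' \<and>
     x' \<in> mspace n \<and> y' \<in> mspace n \<and> mdist m x y < \<delta> \<longrightarrow> mdist n x' y' < \<epsilon>"
  proof (intro exI[of _ \<delta>] conjI \<delta>(1) ballI allI impI; elim conjE)
    fix h m n x y x' y'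
    assume h: "h \<in> bar_generators" and mn: "m \<in> D" "n \<in> D" and xy: "x \<in> mspace m" "y \<in> mspace m"
      "h x = Some x'" "h y = Some y'" "x' \<in> mspace n" "y' \<in> mspace n" "mdist m x y < \<delta>"
    have nbhd: "\<exists>e>0. ball z e \<subseteq> mball_of n z (\<epsilon>/4)" if "z \<in> mspace n" for z
    proof -
      have "open (mball_of n z (\<epsilon>/4))" "z \<in> mball_of n z (\<epsilon>/4)"
        using D(1) mn that \<epsilon>(2) by (auto simp: open_metric_cover_def intro: centre_in_mball_of)
      then show ?thesis by (meson openE)
    qed
    obtain e where e: "e > 0" "ball x' e \<subseteq> mball_of n x' (\<epsilon>/4)" using nbhd[OF xy(5)] by blast
    obtain e' where e': "e' > 0" "ball y' e' \<subseteq> mball_of n y' (\<epsilon>/4)" using nbhd[OF xy(6)] by blast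
    have "compact {x, y}" "{x, y} \<subseteq> dom h" using xy(3,4) by auto
    then have "approximable S h {x, y}"
      using h unfolding bar_generators_def compactly_approximable_def by blast
    moreover have "min e e' > 0" using e e' by simp
    ultimately obtain f where f: "f \<in> S" "{x, y} \<subseteq> dom f" "\<forall>z\<in>{x, y}. dist (val f z) (val h z) < min e e'"
      using approximableE by blast
    have fx: "f x = Some (val f x)" "f y = Some (val f y)" using f(2) by auto
    have "val f x \<in> ball x' e" "val f y \<in> ball y' e'" using f(3) xy(3,4) by (auto simp: dist_commute)
    then have near: "val f x \<in> mspace n" "mdist n x' (val f x) < \<epsilon>/4"
      "val f y \<in> mspace n" "mdist n y' (val f y) < \<epsilon>/4"
      using e(2) e'(2) by auto
    then have "mdist n (val f x) (val f y) < \<epsilon>/2" using \<delta>(2) f(1) mn xy(1,2,7) fx by blast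
    moreover have "mdist n x' y' \<le> mdist n x' (val f x) + mdist n (val f x) y'"
      "mdist n (val f x) y' \<le> mdist n (val f x) (val f y) + mdist n (val f y) y'"
      using near xy(5,6) by (auto intro: mdist_triangle)
    ultimately show "mdist n x' y' < \<epsilon>" using near mdist_commute[of n y' "val f y"] by linarith
  qed
qed

lemma strongly_equicontinuous_pg_bar: "strongly_equicontinuous (pg_bar S)"
proof -
  have "symmetric_maps bar_generators"
    unfolding symmetric_maps_def bar_generators_def
    by (simp add: local_homeo_inverse map_inverse_map_inverse)
  moreover have "closed_under_composition bar_generators"
    unfolding closed_under_composition_def bar_generators_def
    by (simp add: local_homeo_comp map_inverse_comp local_homeo_inverse compactly_approximable_comp)
  moreover have "strong_equicontinuity_condition bar_generators"
    using admissible equicontinuous_bar_generators quasi_local_metric_cover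
    unfolding admissible_generators_def strong_equicontinuity_condition_alt by blast
  ultimately show ?thesis unfolding strongly_equicontinuous_def using generates_bar_generators by blast
qed

section \<open>Independence of the generators\<close>

text \<open>A germ of \<open>H\<close> lies in each set on some neighbourhood, and closure under
  restriction puts it into both on the intersection. Equicontinuity and quasi-effectiveness pass to
  subsets.\<close>

lemma admissible_generators_Int:
  assumes S': "admissible_generators H S'"
  shows "admissible_generators H (S \<inter> S')"
proof -
  interpret S': admissible_pseudogroup H S'
    using locally_compact pseudogroup compactly_generated S' by unfold_locales
  have "h \<in> generated (S \<inter> S')" if h: "h \<in> H" for h
  proof (rule generated_of_germs[OF H_local_homeo[OF h]])
    fix x assume x: "x \<in> dom h"
    obtain U where U: "open U" "x \<in> U" "h |` U \<in> S" using H_germ[OF h x] by metis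
    obtain V where V: "open V" "x \<in> V" "h |` V \<in> S'" using S'.H_germ[OF h x] by metis
    have "h |` (U \<inter> V) \<in> S" "h |` (U \<inter> V) \<in> S'"
      using S_restrict[OF U(3) V(1)] S'.S_restrict[OF V(3) U(1)]
      by (simp_all add: restrict_restrict Int_commute)
    then show "\<exists>O'. open O' \<and> x \<in> O' \<and> h |` O' \<in> S \<inter> S'" using U V by (intro exI[of _ "U \<inter> V"]) auto
  qed
  then have "generates (S \<inter> S') H" using S_subset_H by (auto simp: generates_def)
  moreover have "strong_equicontinuity_condition (S \<inter> S')"
  proof -
    have "equicontinuous_wrt D (S \<inter> S')" if "equicontinuous_wrt D S" for D
      using that unfolding equicontinuous_wrt_def by (meson IntD1)
    then show ?thesis
      using admissible unfolding admissible_generators_def strong_equicontinuity_condition_alt by blast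
  qed
  moreover have "symmetric_maps (S \<inter> S')"
    using S_inverse S'.S_inverse by (simp add: symmetric_maps_def)
  moreover have "closed_under_composition (S \<inter> S')"
    using S_comp S'.S_comp by (simp add: closed_under_composition_def)
  moreover have "closed_under_restriction (S \<inter> S')"
    using S_restrict S'.S_restrict by (simp add: closed_under_restriction_def)
  moreover have "quasi_effectiveness_condition (S \<inter> S')"
    using admissible unfolding admissible_generators_def quasi_effectiveness_condition_def by blast
  ultimately show ?thesis unfolding admissible_generators_def by blast
qed

text \<open>For the inclusion of \<open>pg_tilde S\<close> in \<open>pg_tilde T\<close>, a map
  \<open>f\<close> of \<open>S\<close> approximating \<open>h\<close> lies in \<open>T\<close> only
  as a germ at \<open>x\<close>. That germ extends within \<open>T\<close> to a fixed ball, and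
  since \<open>T \<subseteq> S\<close>, rigidity of \<open>S\<close> makes the extension equal
  \<open>f\<close> on the overlap; hence it approximates \<open>h\<close> equally well.\<close>

lemma pg_tilde_subset_generators:
  assumes T: "admissible_generators H T" "T \<subseteq> S"
  shows "pg_tilde T = pg_tilde S"
proof
  interpret T: admissible_pseudogroup H T
    using locally_compact pseudogroup compactly_generated T(1) by unfold_locales
  show "pg_tilde T \<subseteq> pg_tilde S"
  proof
    fix h assume "h \<in> pg_tilde T"
    then show "h \<in> pg_tilde S"
      unfolding T.pg_tilde_iff pg_tilde_iff using approximable_mono[OF _ order_refl T(2) refl] by meson
  qed
  show "pg_tilde S \<subseteq> pg_tilde T"
  proof
    fix h assume h: "h \<in> pg_tilde S"
    show "h \<in> pg_tilde T"
      unfolding T.pg_tilde_iff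
    proof
      fix x assume x: "x \<in> dom h"
      obtain O' where O': "open O'" "x \<in> O'" "O' \<subseteq> dom h" "approximable S h O'"
        using pg_tildeE[OF h x] .
      \<comment> \<open>Any positive bound would serve as well as \<open>1\<close>: the extension is
        wanted for its common domain.\<close>
      obtain \<rho> where \<rho>: "\<rho> > 0" "\<forall>g\<in>T. \<forall>z\<in>dom g. dist x z < \<rho> \<longrightarrow> dist (val h x) (val g z) < \<rho> \<longrightarrow>
        (\<exists>f\<in>T. ball x \<rho> \<subseteq> dom f \<and> (\<forall>z\<in>ball x \<rho>. dist (val h x) (val f z) < 1) \<and> agree_near z g f)"
        using T.uniform_extension[of 1 x "val h x"] by auto
      have "approximable T h (ball x \<rho> \<inter> O')"
        unfolding approximable_def
      proof (intro allI impI)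
        fix \<epsilon> :: real assume "\<epsilon> > 0"
        then have "min \<epsilon> \<rho> > 0" using \<rho>(1) by simp
        from approximableE[OF O'(4) this] obtain f where f: "f \<in> S" "O' \<subseteq> dom f"
          "\<forall>y\<in>O'. dist (val f y) (val h y) < min \<epsilon> \<rho>" .
        have "f \<in> H" "x \<in> dom f" using f(1,2) S_subset_H O'(2) by blast+
        then obtain V where V: "open V" "x \<in> V" "V \<subseteq> dom f" "f |` V \<in> T" using T.H_germ by metis
        have xV: "x \<in> dom (f |` V)" "val (f |` V) x = val f x" using V(2) \<open>x \<in> dom f\<close> by auto
        have "dist (val h x) (val (f |` V) x) < \<rho>"
          using bspec[OF f(3) O'(2)] V(2) by (simp add: dist_commute)
        then obtain g where g: "g \<in> T" "ball x \<rho> \<subseteq> dom g" "agree_near x (f |` V) g"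
          using \<rho> V(4) xV(1) by (metis dist_self)
        have "agree_near x f g"
          using agree_near_trans[OF agree_near_restrict[OF V(1,2) S_dom_open[OF f(1)] \<open>x \<in> dom f\<close>] g(3)] .
        then have "f z = g z" if "z \<in> ball x \<rho> \<inter> O'" for z
          using S_agree[OF f(1)] g(1,2) T(2) f(2) that by blast
        then have "\<forall>z\<in>ball x \<rho> \<inter> O'. dist (val g z) (val h z) < \<epsilon>"
          using f(3) by (metis IntD2 min_less_iff_conj)
        then show "\<exists>f\<in>T. ball x \<rho> \<inter> O' \<subseteq> dom f \<and> (\<forall>z\<in>ball x \<rho> \<inter> O'. dist (val f z) (val h z) < \<epsilon>)"
          using g(1,2) by blast
      qed
      then show "\<exists>O'. open O' \<and> x \<in> O' \<and> O' \<subseteq> dom h \<and> approximable T h O'"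
        using O' \<rho>(1) by (intro exI[of _ "ball x \<rho> \<inter> O'"] conjI open_Int open_ball IntI) auto
    qed
  qed
qed

lemma pg_tilde_independent:
  assumes S': "admissible_generators H S'"
  shows "pg_tilde S' = pg_tilde S"
proof -
  interpret S': admissible_pseudogroup H S'
    using locally_compact pseudogroup compactly_generated S' by unfold_locales
  show ?thesis
    using pg_tilde_subset_generators S'.pg_tilde_subset_generators admissible_generators_Int[OF S']
    by (metis Int_lower1 Int_lower2)
qed

end

theorem theorem12p1:
  fixes H S :: "('a::polish_space \<rightharpoonup> 'a) set"
  assumes "locally compact (UNIV :: 'a set)"
    and "pseudogroup H"
    and "quasi_effective H"
    and "compactly_generated H"
    and "strongly_equicontinuous H"
    and "admissible_generators H S"
  shows "(closed_under_composition (pg_tilde S) \<and> closed_under_combination (pg_tilde S) \<and>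
            closed_under_restriction (pg_tilde S)) \<and>
         (\<forall>h\<in>pg_tilde S. \<forall>x\<in>dom h. \<exists>U. open U \<and> x \<in> U \<and> U \<subseteq> dom h \<and> local_homeo (h |` U)) \<and>
         (pseudogroup (pg_bar S) \<and> H \<subseteq> pg_bar S) \<and>
         strongly_equicontinuous (pg_bar S) \<and>
         (\<forall>x. orbit (pg_bar S) x = closure (orbit H x)) \<and>
         (\<forall>S'. admissible_generators H S' \<longrightarrow> pg_tilde S' = pg_tilde S \<and> pg_bar S' = pg_bar S)"
proof -
  interpret admissible_pseudogroup H S
    using assms by unfold_locales
  have "\<exists>U. open U \<and> x \<in> U \<and> U \<subseteq> dom h \<and> local_homeo (h |` U)" if "h \<in> pg_tilde S" "x \<in> dom h" for h x
    using pg_tilde_local_inverse[OF that] by metis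
  moreover have "closed_under_composition (pg_tilde S)" "closed_under_combination (pg_tilde S)"
    "closed_under_restriction (pg_tilde S)"
    unfolding closed_under_composition_def closed_under_combination_def closed_under_restriction_def
    using pg_tilde_comp pg_tilde_combination pg_tilde_restrict by blast+
  moreover have "pg_tilde S' = pg_tilde S \<and> pg_bar S' = pg_bar S" if "admissible_generators H S'" for S'
    using pg_tilde_independent[OF that] by (simp add: pg_bar_def)
  ultimately show ?thesis
    using pseudogroup_pg_bar H_subset_pg_bar strongly_equicontinuous_pg_bar orbit_pg_bar by blast
qed

end
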